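(* For each $n\ge1$ let $\mathbf{p}^{(n)}=(p_i^{(n)})_{i\in\mathbb{I}}$ be a probability distribution on $\mathbb{I}$ and let $G^{(n)}=(G_1^{(n)},\dots,G_n^{(n)})$ be i.i.d. with $\mathbb{P}(G_j^{(n)}=i)=p_i^{(n)}$. Assume that $$\|\mathbf{p}^{(n)}\|_\infty=\max_{i\in\mathbb{I}}p_i^{(n)}\underset{n\to+\infty}{\longrightarrow}0.$$ Let $c_j$ denote the number of cycles of length $j$ of $\mathrm{std}(G^{(n)})$. Then, for every integer $k\ge1$, $$(c_1,\dots,c_k)\ \overset{(d)}{\underset{n\to+\infty}{\longrightarrow}}\ \mathcal{P}(1)\otimes\mathcal{P}\left(\tfrac12\right)\otimes\cdots\otimes\mathcal{P}\left(\tfrac1k\right).$$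
   Context: $\mathbb{I}\subset\mathbb{R}$ is a countable set. For $g=(g_1,\dots,g_n)\in\mathbb{R}^n$, the standardized permutation $\sigma=\mathrm{std}(g)\in\mathfrak{S}_n$ is defined by: $\sigma(j)<\sigma(k)$ if and only if $g_j<g_k$, or $g_j=g_k$ and $j<k$. $\mathcal{P}(\lambda)$ denotes the Poisson distribution with parameter $\lambda$. *)

theory Defs
  imports "HOL-Probability.Probability" "HOL-Combinatorics.Orbits"
begin

definition is_std :: "nat \<Rightarrow> (nat \<Rightarrow> real) \<Rightarrow> (nat \<Rightarrow> nat) \<Rightarrow> bool" where
  "is_std n g \<sigma> \<longleftrightarrow> \<sigma> permutes {1..n} \<and>
     (\<forall>j\<in>{1..n}. \<forall>k\<in>{1..n}. \<sigma> j < \<sigma> k \<longleftrightarrow> g j < g k \<or> (g j = g k \<and> j < k))"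

lemma is_std_eq_card:
  assumes "is_std n g \<sigma>" and j: "j \<in> {1..n}"
  shows "\<sigma> j = card {k\<in>{1..n}. g k < g j \<or> (g k = g j \<and> k \<le> j)}"
proof -
  from assms have p: "\<sigma> permutes {1..n}"
    and ord: "\<And>j k. j \<in> {1..n} \<Longrightarrow> k \<in> {1..n} \<Longrightarrow>
      \<sigma> j < \<sigma> k \<longleftrightarrow> g j < g k \<or> (g j = g k \<and> j < k)"
    by (auto simp: is_std_def)
  have inj: "inj \<sigma>" using p by (rule permutes_inj)
  have \<sigma>j: "\<sigma> j \<in> {1..n}" using j permutes_in_image[OF p] by blast
  have im: "\<sigma> ` {1..n} = {1..n}" using p by (rule permutes_image)
  have "{k\<in>{1..n}. g k < g j \<or> (g k = g j \<and> k \<le> j)} = {k\<in>{1..n}. \<sigma> k \<le> \<sigma> j}"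
  proof (rule Collect_cong)
    fix k
    show "(k \<in> {1..n} \<and> (g k < g j \<or> (g k = g j \<and> k \<le> j))) \<longleftrightarrow> (k \<in> {1..n} \<and> \<sigma> k \<le> \<sigma> j)"
    proof (cases "k \<in> {1..n}")
      case True
      have "\<sigma> k = \<sigma> j \<longleftrightarrow> k = j" using inj by (simp add: inj_eq)
      with ord[OF True j] show ?thesis unfolding le_less by blast
    qed blast
  qed
  moreover have "\<sigma> ` {k\<in>{1..n}. \<sigma> k \<le> \<sigma> j} = {m\<in>\<sigma> ` {1..n}. m \<le> \<sigma> j}"
    by blast
  moreover have "{m\<in>\<sigma> ` {1..n}. m \<le> \<sigma> j} = {1..\<sigma> j}"
    unfolding im using \<sigma>j by auto
  moreover have "card (\<sigma> ` {k\<in>{1..n}. \<sigma> k \<le> \<sigma> j}) = card {k\<in>{1..n}. \<sigma> k \<le> \<sigma> j}"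
    by (rule card_image) (rule inj_on_subset[OF inj], simp)
  ultimately show ?thesis by simp
qed

lemma ex1_is_std: "\<exists>!\<sigma>. is_std n g \<sigma>"
proof (rule ex_ex1I)
  define A where "A j = {k\<in>{1..n}. g k < g j \<or> (g k = g j \<and> k \<le> j)}" for j
  define \<sigma> where "\<sigma> j = (if j \<in> {1..n} then card (A j) else j)" for j
  have fin: "finite (A j)" for j by (simp add: A_def)
  have less: "card (A j) < card (A k)"
    if "j \<in> {1..n}" "k \<in> {1..n}" "g j < g k \<or> (g j = g k \<and> j < k)" for j k
  proof (rule psubset_card_mono[OF fin])
    have "A j \<subseteq> A k" "k \<in> A k" "k \<notin> A j"
      using that by (auto simp: A_def)
    then show "A j \<subset> A k" by blast
  qed
  have iff: "\<sigma> j < \<sigma> k \<longleftrightarrow> g j < g k \<or> (g j = g k \<and> j < k)"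
    if jk: "j \<in> {1..n}" "k \<in> {1..n}" for j k
  proof -
    consider "g j < g k \<or> (g j = g k \<and> j < k)" | "j = k" | "g k < g j \<or> (g k = g j \<and> k < j)"
      by linarith
    then show ?thesis
      using less[OF jk] less[OF jk(2,1)] jk by cases (auto simp: \<sigma>_def)
  qed
  have inj: "inj_on \<sigma> {1..n}"
  proof (rule inj_onI)
    fix j k assume jk: "j \<in> {1..n}" "k \<in> {1..n}" "\<sigma> j = \<sigma> k"
    show "j = k" using iff[OF jk(1,2)] iff[OF jk(2,1)] jk(3) by linarith
  qed
  have sub: "\<sigma> ` {1..n} \<subseteq> {1..n}"
  proof
    fix m assume "m \<in> \<sigma> ` {1..n}"
    then obtain j where j: "j \<in> {1..n}" "m = card (A j)" by (auto simp: \<sigma>_def)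
    have "card (A j) \<le> card {1..n}" by (rule card_mono) (auto simp: A_def)
    moreover have "j \<in> A j" using j by (simp add: A_def)
    then have "card (A j) > 0" using fin card_gt_0_iff by blast
    ultimately show "m \<in> {1..n}" using j by simp
  qed
  have "bij_betw \<sigma> {1..n} {1..n}"
    using inj sub by (simp add: bij_betw_def endo_inj_surj)
  then have "\<sigma> permutes {1..n}"
    by (rule bij_imp_permutes) (auto simp: \<sigma>_def)
  with iff show "\<exists>\<sigma>. is_std n g \<sigma>" by (auto simp: is_std_def)
next
  fix \<sigma> \<tau> assume st: "is_std n g \<sigma>" "is_std n g \<tau>"
  show "\<sigma> = \<tau>"
  proof
    fix j show "\<sigma> j = \<tau> j"
    proof (cases "j \<in> {1..n}")
      case True
      then show ?thesis by (simp only: is_std_eq_card[OF st(1)] is_std_eq_card[OF st(2)])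
    next
      case False
      then show ?thesis using st by (auto simp: is_std_def permutes_def)
    qed
  qed
qed

definition std :: "nat \<Rightarrow> (nat \<Rightarrow> real) \<Rightarrow> nat \<Rightarrow> nat" where
  "std n g = (THE \<sigma>. is_std n g \<sigma>)"

lemma is_std_std: "is_std n g (std n g)"
  unfolding std_def by (rule theI'[OF ex1_is_std])

text \<open>The cycles of a permutation of \<open>{1..n}\<close> are identified with their supports, the orbits;
  fixed points are cycles of length 1.\<close>

definition cycle_count :: "nat \<Rightarrow> (nat \<Rightarrow> nat) \<Rightarrow> nat \<Rightarrow> nat" where
  "cycle_count n \<sigma> j = card {C \<in> orbit \<sigma> ` {1..n}. card C = j}"

text \<open>Weak convergence of measures on the Borel sets of the topological space \<open>X\<close>.  The library's
  \<open>weak_conv_m\<close> only covers measures on the real line.\<close>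

definition weak_conv_on :: "'a topology \<Rightarrow> (nat \<Rightarrow> 'a measure) \<Rightarrow> 'a measure \<Rightarrow> bool" where
  "weak_conv_on X \<mu> \<nu> \<longleftrightarrow>
     (\<forall>f :: 'a \<Rightarrow> real. continuous_map X euclideanreal f \<and> bounded (f ` topspace X) \<longrightarrow>
        (\<lambda>n. \<integral>x. f x \<partial>\<mu> n) \<longlonglongrightarrow> (\<integral>x. f x \<partial>\<nu>))"

end

(* Reading the letters of G backwards along a cycle of std(G) turns every position into a periodic
   infinite word, and the order of the positions is the lexicographic order of these words.  Hence
   G is determined by the multiset of its words (Gessel-Reutenauer), the admissible multisets are
   exactly those invariant under the shift, and the probability of G is a product over the multiset.
   A j-cycle becomes the set of the j rotations of a primitive word, so adding or deleting such a
   set of rotations multiplies probabilities by the weight of the word.  The resulting size-bias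
   identities compare words of length n with words of length n - j, up to errors of order max p:
   they reduce P(c_1 = m_1, ..., c_k = m_k) to the probability that there is no cycle of length
   at most k.  The latter is an alternating series of binomial moments of the number of short
   necklaces; the r-th moment converges to H^r / r! and is bounded by it, where
   H = 1 + 1/2 + ... + 1/k, and so the series converges to exp (-H) by Tannery's theorem. *)

theory Submission
  imports Defs "HOL-Combinatorics.Cycles"
begin

section \<open>Lexicographic order on infinite words\<close>

text \<open>Inserting a cycle into \<open>std g\<close> relabels positions throughout; on the
  multiset of words it is just the addition of one orbit, and this is why the law is transported to
  multisets. The parameter 1/l comes from the rotations: an l-cycle is seen through each of its l
  words, while the weights of all primitive words of length l add up to almost 1. Two accidents
  cause the error terms: a random word fails to be primitive, or an added word is already present.
  Both have probability at most a constant times the largest letter probability. The size-bias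
  recursion fixes only the ratios of the limiting probabilities, so the probability of having no
  short cycle needs an argument of its own. There, distinct necklaces are counted instead of cycles,
  because the integral formula sums over each distinct word once; the two counts vanish together,
  which is what links the moments to the recursion.\<close>

definition shift :: "(nat \<Rightarrow> 'a) \<Rightarrow> nat \<Rightarrow> 'a" where
  "shift U i = U (Suc i)"

lemma funpow_shift: "(shift ^^ k) U i = U (i + k)"
  by (induction k arbitrary: i) (simp_all add: shift_def)

text \<open>The function type already carries the pointwise order, so the lexicographic order gets
  predicates of its own and becomes a \<open>linorder\<close> by interpretation.\<close>

definition lex_less :: "(nat \<Rightarrow> 'a::linorder) \<Rightarrow> (nat \<Rightarrow> 'a) \<Rightarrow> bool" where
  "lex_less U V \<longleftrightarrow> (\<exists>i. (\<forall>j<i. U j = V j) \<and> U i < V i)"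

definition lex_le :: "(nat \<Rightarrow> 'a::linorder) \<Rightarrow> (nat \<Rightarrow> 'a) \<Rightarrow> bool" where
  "lex_le U V \<longleftrightarrow> U = V \<or> lex_less U V"

lemma lex_less_trans:
  assumes "lex_less U V" "lex_less V W"
  shows "lex_less U W"
proof -
  from assms obtain i j where i: "\<And>k. k < i \<Longrightarrow> U k = V k" "U i < V i"
    and j: "\<And>k. k < j \<Longrightarrow> V k = W k" "V j < W j"
    unfolding lex_less_def by blast
  have "U (min i j) < W (min i j)"
    using i j by (cases i j rule: linorder_cases) auto
  moreover have "U k = W k" if "k < min i j" for k using i j that by auto
  ultimately show ?thesis unfolding lex_less_def by blast
qed

lemma lex_less_irrefl: "\<not> lex_less U U"
  by (simp add: lex_less_def)

lemma first_difference:
  assumes "U \<noteq> (V :: nat \<Rightarrow> 'a)"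
  obtains i where "\<forall>j<i. U j = V j" "U i \<noteq> V i"
proof -
  from assms obtain k where "U k \<noteq> V k" by blast
  then show thesis using that[of "LEAST i. U i \<noteq> V i"] LeastI[of "\<lambda>i. U i \<noteq> V i" k]
    not_less_Least[of _ "\<lambda>i. U i \<noteq> V i"] by blast
qed

lemma lex_le_total: "lex_le U V \<or> lex_le V U"
proof (cases "U = V")
  case False
  then obtain i where "\<forall>j<i. U j = V j" "U i \<noteq> V i" by (rule first_difference)
  then show ?thesis unfolding lex_le_def lex_less_def by (metis linorder_neqE)
qed (simp add: lex_le_def)

interpretation lex: linorder lex_le lex_less
proof
  fix U V W :: "nat \<Rightarrow> 'a"
  show "lex_less U V \<longleftrightarrow> lex_le U V \<and> \<not> lex_le V U"
    using lex_less_trans lex_less_irrefl unfolding lex_le_def by blast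
  show "lex_le U U" by (simp add: lex_le_def)
  show "lex_le U V \<Longrightarrow> lex_le V W \<Longrightarrow> lex_le U W"
    using lex_less_trans unfolding lex_le_def by blast
  show "lex_le U V \<Longrightarrow> lex_le V U \<Longrightarrow> U = V"
    using lex_less_trans lex_less_irrefl unfolding lex_le_def by blast
  show "lex_le U V \<or> lex_le V U" by (rule lex_le_total)
qed

text \<open>The words are compared by first letter and then by tail. A word is described through its
  shift and its letter at 0, since letters will be prepended by an inverse of the shift.\<close>

lemma lex_le_ConsI:
  assumes "shift U' = U" "shift V' = V" "U' 0 < V' 0 \<or> U' 0 = V' 0 \<and> lex_le U V"
  shows "lex_le U' V'"
proof -
  have *: "U' (Suc i) = U i" "V' (Suc i) = V i" for i
    using assms(1,2) by (auto simp: shift_def)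
  consider "U' 0 < V' 0" | "U' 0 = V' 0" "U = V" | i where "U' 0 = V' 0" "\<forall>j<i. U j = V j" "U i < V i"
    using assms(3) unfolding lex_le_def lex_less_def by blast
  then show ?thesis
  proof cases
    case 1
    then show ?thesis unfolding lex_le_def lex_less_def by (intro disjI2 exI[of _ 0]) auto
  next
    case 2
    then have "U' j = V' j" for j using * by (cases j) auto
    then show ?thesis by (auto simp: lex_le_def)
  next
    case 3
    have "U' j = V' j" if "j < Suc i" for j using 3 * that by (cases j) auto
    then show ?thesis using 3 * unfolding lex_le_def lex_less_def
      by (intro disjI2 exI[of _ "Suc i"]) auto
  qed
qed

text \<open>Two sorted lists with the same multiset coincide. This identifies words position by
  position, both for injectivity and for surjectivity of \<open>cycle_words\<close>.\<close>

lemma sorted_enumeration_unique: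
  fixes V W :: "nat \<Rightarrow> nat \<Rightarrow> 'a::linorder"
  assumes "\<And>x y. 1 \<le> x \<Longrightarrow> x < y \<Longrightarrow> y \<le> n \<Longrightarrow> lex_le (V x) (V y)"
    and "\<And>x y. 1 \<le> x \<Longrightarrow> x < y \<Longrightarrow> y \<le> n \<Longrightarrow> lex_le (W x) (W y)"
    and "image_mset V (mset_set {1..n}) = image_mset W (mset_set {1..n})"
    and "x \<in> {1..n}"
  shows "V x = W x"
proof -
  have eq: "mset (map V [1..<Suc n]) = mset (map W [1..<Suc n])"
    using assms(3) by (simp add: atLeastLessThanSuc_atLeastAtMost del: upt_Suc)
  have "lex.sorted (map V [1..<Suc n])" "lex.sorted (map W [1..<Suc n])"
    using assms(1,2) by (auto simp: sorted_wrt_iff_nth_less simp del: upt_Suc)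
  then have "map V [1..<Suc n] = map W [1..<Suc n]"
    using lex.properties_for_sort eq by (metis lex.sorted_sort_id)
  moreover have "[1..<Suc n] ! (x - 1) = x" "x - 1 < length [1..<Suc n]"
    using assms(4) by (auto simp del: upt_Suc)
  ultimately show ?thesis by (metis nth_map)
qed

lemma sorted_enumeration_exists:
  fixes N :: "(nat \<Rightarrow> 'a::linorder) multiset"
  assumes "size N = n"
  obtains V where "\<And>x y. 1 \<le> x \<Longrightarrow> x < y \<Longrightarrow> y \<le> n \<Longrightarrow> lex_le (V x) (V y)"
    and "image_mset V (mset_set {1..n}) = N"
proof -
  obtain ys where ys: "mset ys = N" using ex_mset by blast
  define xs where "xs = lex.sort_key (\<lambda>U. U) ys"
  have mset: "mset xs = N" by (simp add: xs_def ys)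
  then have len: "length xs = n" using assms by (metis size_mset)
  have srt: "lex.sorted xs" by (simp add: xs_def)
  define V where "V x = xs ! (x - 1)" for x
  have "map V [1..<Suc n] = xs"
    by (rule nth_equalityI) (simp_all add: len V_def del: upt_Suc)
  then have "mset (map V [1..<Suc n]) = N" by (simp add: mset del: upt_Suc)
  then have "image_mset V (mset_set {1..n}) = N"
    by (simp add: atLeastLessThanSuc_atLeastAtMost del: upt_Suc)
  moreover have "lex_le (V x) (V y)" if "1 \<le> x" "x < y" "y \<le> n" for x y
    using srt that len unfolding V_def sorted_wrt_iff_nth_less by auto
  ultimately show thesis using that by blast
qed

section \<open>The Gessel--Reutenauer correspondence\<close>

text \<open>The letters met when walking backwards along the cycle of \<open>std n g\<close> through \<open>x\<close>: in this
  direction the order of the positions is the lexicographic order of the words.\<close>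

definition cycle_word :: "nat \<Rightarrow> (nat \<Rightarrow> real) \<Rightarrow> nat \<Rightarrow> nat \<Rightarrow> real" where
  "cycle_word n g x i = g ((inv (std n g) ^^ Suc i) x)"

definition cycle_words :: "nat \<Rightarrow> (nat \<Rightarrow> real) \<Rightarrow> (nat \<Rightarrow> real) multiset" where
  "cycle_words n g = image_mset (cycle_word n g) (mset_set {1..n})"

lemma std_permutes: "std n g permutes {1..n}"
  using is_std_std[of n g] by (simp add: is_std_def)

lemma inv_std_permutes: "inv (std n g) permutes {1..n}"
  using std_permutes by (rule permutes_inv)

text \<open>The defining property of \<open>std\<close> read at preimages. Iterating it replaces the
  comparison of two positions by a comparison of letters followed by one of earlier positions, which
  unfolds to the lexicographic order.\<close>

lemma inv_std_less_iff:
  assumes "x \<in> {1..n}" "y \<in> {1..n}"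
  shows "x < y \<longleftrightarrow> g (inv (std n g) x) < g (inv (std n g) y) \<or>
    g (inv (std n g) x) = g (inv (std n g) y) \<and> inv (std n g) x < inv (std n g) y"
proof -
  let ?p = "inv (std n g)"
  have "?p x \<in> {1..n}" "?p y \<in> {1..n}"
    using assms permutes_in_image[OF inv_std_permutes] by blast+
  then have "std n g (?p x) < std n g (?p y) \<longleftrightarrow> g (?p x) < g (?p y) \<or> g (?p x) = g (?p y) \<and> ?p x < ?p y"
    using is_std_std[of n g] by (auto simp: is_std_def)
  then show ?thesis by (simp add: permutes_inverses[OF std_permutes])
qed

lemma funpow_inv_std_in: "x \<in> {1..n} \<Longrightarrow> (inv (std n g) ^^ k) x \<in> {1..n}"
  by (induction k) (use permutes_in_image[OF inv_std_permutes] in auto)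

lemma shift_cycle_word: "shift (cycle_word n g x) = cycle_word n g (inv (std n g) x)"
  by (simp add: fun_eq_iff shift_def cycle_word_def funpow_swap1)

lemma funpow_shift_cycle_word:
  "(shift ^^ k) (cycle_word n g x) = cycle_word n g ((inv (std n g) ^^ k) x)"
  by (induction k) (simp_all add: shift_cycle_word)

text \<open>As long as the letters agree, ties are broken by position, so the order of the positions
  is carried one step further back.\<close>

lemma funpow_inv_std_less:
  assumes "x \<in> {1..n}" "y \<in> {1..n}" "x < y" "\<forall>j<i. cycle_word n g x j = cycle_word n g y j"
  shows "(inv (std n g) ^^ i) x < (inv (std n g) ^^ i) y"
  using assms(4)
proof (induction i)
  case (Suc i)
  then have "(inv (std n g) ^^ i) x < (inv (std n g) ^^ i) y" by simp
  moreover have "cycle_word n g x i = cycle_word n g y i" using Suc.prems by simp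
  ultimately show ?case
    using inv_std_less_iff[where g=g, OF funpow_inv_std_in[where g=g, OF assms(1)]
        funpow_inv_std_in[where g=g, OF assms(2)], of i i]
    by (simp add: cycle_word_def)
qed (use assms in simp)

text \<open>Only a weak inequality can hold: positions on different cycles may carry the same
  word.\<close>

lemma cycle_word_mono:
  assumes "x \<in> {1..n}" "y \<in> {1..n}" "x < y"
  shows "lex_le (cycle_word n g x) (cycle_word n g y)"
proof (cases "cycle_word n g x = cycle_word n g y")
  case False
  then obtain i where i: "\<forall>j<i. cycle_word n g x j = cycle_word n g y j"
    "cycle_word n g x i \<noteq> cycle_word n g y i" by (rule first_difference)
  then have "cycle_word n g x i < cycle_word n g y i"
    using inv_std_less_iff[where g=g, OF funpow_inv_std_in[where g=g, OF assms(1)]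
        funpow_inv_std_in[where g=g, OF assms(2)], of i i]
      funpow_inv_std_less[OF assms i(1)] by (auto simp: cycle_word_def)
  with i(1) show ?thesis by (auto simp: lex_le_def lex_less_def)
qed (simp add: lex_le_def)

text \<open>The words read along cycles are primitive: the rotation that identifies two equal words
  would move the positions in a strictly monotone way.\<close>

lemma cycle_word_inj_on_orbit:
  assumes "x \<in> {1..n}" "y = (inv (std n g) ^^ d) x" "cycle_word n g x = cycle_word n g y"
  shows "x = y"
proof (rule ccontr)
  assume "x \<noteq> y"
  let ?p = "inv (std n g)"
  have yn: "y \<in> {1..n}" using assms funpow_inv_std_in by blast
  \<comment> \<open>\<open>y\<close> is one \<open>d\<close>-fold step ahead of \<open>x\<close>, so
    comparing the two at iterate \<open>i * d\<close> compares consecutive terms of one sequence in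
    1..n. Increasing, it would pass \<open>n\<close>; decreasing, it would fall below 0.\<close>
  have it: "(?p ^^ (i * d)) y = (?p ^^ (Suc i * d)) x" for i
  proof -
    have "Suc i * d = i * d + d" by simp
    then show ?thesis by (simp only: funpow_add assms(2) o_apply)
  qed
  have mem: "(?p ^^ j) x \<in> {1..n}" for j using assms(1) by (rule funpow_inv_std_in)
  consider "x < y" | "y < x" using \<open>x \<noteq> y\<close> by linarith
  then show False
  proof cases
    case 1
    have "(?p ^^ (i * d)) x < (?p ^^ (Suc i * d)) x" for i
      using funpow_inv_std_less[OF assms(1) yn 1] assms(3) it by metis
    then have "strict_mono (\<lambda>i. (?p ^^ (i * d)) x)" by (simp add: strict_mono_Suc_iff)
    then have "Suc n \<le> (?p ^^ (Suc n * d)) x" by (rule strict_mono_imp_increasing)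
    with mem show False by (metis Suc_n_not_le_n atLeastAtMost_iff order_trans)
  next
    case 2
    have dec: "(?p ^^ (Suc i * d)) x < (?p ^^ (i * d)) x" for i
      using funpow_inv_std_less[OF yn assms(1) 2] assms(3) it by metis
    have "(?p ^^ (i * d)) x + i \<le> x" for i
    proof (induction i)
      case (Suc i)
      then show ?case using dec[of i] by simp
    qed simp
    from this[of "Suc x"] show False by simp
  qed
qed

lemma orbit_image:
  assumes "\<And>x. f (h x) = h (k x)"
  shows "orbit f (h x) = h ` orbit k x"
proof -
  have "(f ^^ n) (h x) = h ((k ^^ n) x)" for n
    by (induction n) (simp_all add: assms)
  then show ?thesis by (auto simp: orbit_altdef)
qed

lemma permutation_std: "permutation (std n g)"
  unfolding permutation_permutes using std_permutes finite_atLeastAtMost by blast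

lemma orbit_inv_std: "orbit (inv (std n g)) x = orbit (std n g) x"
  by (rule orbit_inv_eq) (rule permutation_std)

lemma self_in_orbit_std: "x \<in> orbit (std n g) x"
  by (rule permutation_self_in_orbit) (rule permutation_std)

lemma orbit_shift_cycle_word:
  "orbit shift (cycle_word n g x) = cycle_word n g ` orbit (std n g) x"
  using orbit_image[where f=shift and h="cycle_word n g" and k="inv (std n g)", OF shift_cycle_word] by (simp add: orbit_inv_std)

lemma cycle_word_in_orbit: "cycle_word n g x \<in> orbit shift (cycle_word n g x)"
  unfolding orbit_shift_cycle_word using self_in_orbit_std by (rule imageI)

text \<open>By \<open>cycle_word_inj_on_orbit\<close> no two positions of a cycle share a word, so
  cycle length and least period agree.\<close>

lemma card_orbit_cycle_word:
  assumes "x \<in> {1..n}"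
  shows "card (orbit shift (cycle_word n g x)) = card (orbit (std n g) x)"
  unfolding orbit_shift_cycle_word
proof (rule card_image, rule inj_onI)
  let ?p = "inv (std n g)"
  fix y z assume yz: "y \<in> orbit (std n g) x" "z \<in> orbit (std n g) x"
    "cycle_word n g y = cycle_word n g z"
  then have "x \<in> orbit (std n g) y"
    using orbit_swap[OF self_in_orbit_std] by blast
  then have "z \<in> orbit ?p y" and "y \<in> orbit ?p x"
    using yz orbit_trans[OF yz(2)] by (simp_all add: orbit_inv_std)
  then obtain d where "z = (?p ^^ d) y" by (auto simp: orbit_altdef)
  moreover have "y \<in> {1..n}"
    using \<open>y \<in> orbit ?p x\<close> assms funpow_inv_std_in by (fastforce simp: orbit_altdef)
  ultimately show "y = z" using yz(3) cycle_word_inj_on_orbit by blast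
qed

lemma size_cycle_words: "size (cycle_words n g) = n"
  by (simp add: cycle_words_def)

lemma image_mset_permutes:
  assumes "\<pi> permutes A" "finite A"
  shows "image_mset (\<lambda>x. h (\<pi> x)) (mset_set A) = image_mset h (mset_set A)"
proof -
  have "image_mset \<pi> (mset_set A) = mset_set A"
    using assms by (subst image_mset_mset_set) (auto simp: permutes_image intro: permutes_inj_on)
  then show ?thesis by (metis (no_types, lifting) comp_apply ext image_mset.compositionality)
qed

lemma shift_cycle_words: "image_mset shift (cycle_words n g) = cycle_words n g"
  using image_mset_permutes[OF inv_std_permutes[of n g], of "cycle_word n g"]
  by (simp add: cycle_words_def multiset.map_comp comp_def shift_cycle_word)

text \<open>The shift maps the finite support onto itself, hence permutes it.
  \<open>perm_restrict\<close> extends it by the identity to a permutation of the whole type, which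
  has finite order. The common period makes \<open>shift ^^ (P - 1)\<close> an inverse of the shift
  on \<open>N\<close>.\<close>

lemma shift_invariant_period:
  assumes "image_mset shift N = N"
  obtains P where "P > 0" "\<And>U. U \<in># N \<Longrightarrow> (shift ^^ P) U = U"
proof -
  let ?f = "perm_restrict shift (set_mset N)"
  have im: "shift ` set_mset N = set_mset N" using assms by (metis set_image_mset)
  then have "bij_betw shift (set_mset N) (set_mset N)"
    by (simp add: bij_betw_def finite_surj_inj eq_card_imp_inj_on)
  then have "bij_betw ?f (set_mset N) (set_mset N)"
    by (subst bij_betw_cong[where g=shift]) (simp_all add: perm_restrict_simps)
  then have "?f permutes set_mset N"
    by (rule bij_imp_permutes) (simp add: perm_restrict_simps)
  then have "permutation ?f" unfolding permutation_permutes by blast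
  then obtain P where P: "?f ^^ P = id" "P > 0" by (rule permutation_is_nilpotent)
  have eq: "(shift ^^ k) U = (?f ^^ k) U \<and> (shift ^^ k) U \<in># N" if "U \<in># N" for U k
  proof (induction k)
    case (Suc k)
    then show ?case using im by (auto simp: perm_restrict_simps)
  qed (simp add: that)
  then have "(shift ^^ P) U = U" if "U \<in># N" for U
    using P(1) that by (metis id_apply)
  with P(2) show thesis using that by blast
qed

text \<open>Sorting the multiset recovers the word at each position, and the word at
  \<open>x\<close> contains the letter \<open>g x\<close>. Fixing the value 0 off 1..n matches the
  default value of the random vector below.\<close>

lemma inj_on_cycle_words: "inj_on (cycle_words n) {g. \<forall>x. x \<notin> {1..n} \<longrightarrow> g x = 0}"
proof (rule inj_onI)
  fix g g' assume g: "g \<in> {g. \<forall>x. x \<notin> {1..n} \<longrightarrow> g x = 0}"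
    "g' \<in> {g. \<forall>x. x \<notin> {1..n} \<longrightarrow> g x = 0}" and eq: "cycle_words n g = cycle_words n g'"
  obtain P where P: "P > 0" "\<And>U. U \<in># cycle_words n g \<Longrightarrow> (shift ^^ P) U = U"
    using shift_invariant_period[OF shift_cycle_words] by metis
  \<comment> \<open>The word at \<open>x\<close> starts with the letter at the preceding position,
    so \<open>h x\<close> itself stands at the end of the period. That \<open>P\<close> steps really
    return to \<open>x\<close> follows from injectivity along the cycle.\<close>
  have letter: "h x = cycle_word n h x (P - 1)"
    if "x \<in> {1..n}" "cycle_words n h = cycle_words n g" for h x
  proof -
    have "cycle_word n h x \<in># cycle_words n h" using that(1) by (simp add: cycle_words_def)
    then have "cycle_word n h ((inv (std n h) ^^ P) x) = cycle_word n h x"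
      using P(2) that(2) by (simp flip: funpow_shift_cycle_word)
    then have "x = (inv (std n h) ^^ P) x"
      using that(1) by (metis cycle_word_inj_on_orbit)
    then show ?thesis using P(1) by (simp add: cycle_word_def del: funpow.simps)
  qed
  have W: "cycle_word n g x = cycle_word n g' x" if "x \<in> {1..n}" for x
    by (rule sorted_enumeration_unique[OF _ _ _ that])
      (use eq in \<open>auto simp: cycle_words_def intro!: cycle_word_mono\<close>)
  show "g = g'"
  proof
    fix x show "g x = g' x"
      using g letter[of x g] letter[of x g'] eq W[of x] by (cases "x \<in> {1..n}") auto
  qed
qed

text \<open>An inverse Burrows-Wheeler transform: sort the words and write down the letter that
  cyclically precedes each of them. Standardization sorts stably by that letter, which is the same
  as sorting the words after it has been prepended.\<close>

lemma cycle_words_surj: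
  assumes "size N = n" "image_mset shift N = N"
  obtains g where "\<forall>x. x \<notin> {1..n} \<longrightarrow> g x = 0" "cycle_words n g = N"
proof -
  obtain P where P: "P > 0" "\<And>U. U \<in># N \<Longrightarrow> (shift ^^ P) U = U"
    using shift_invariant_period[OF assms(2)] by metis
  obtain V where V: "\<And>x y. 1 \<le> x \<Longrightarrow> x < y \<Longrightarrow> y \<le> n \<Longrightarrow> lex_le (V x) (V y)"
    and VN: "image_mset V (mset_set {1..n}) = N"
    using sorted_enumeration_exists[OF assms(1)] by metis
  \<comment> \<open>\<open>T\<close> prepends the cyclically preceding letter: on \<open>N\<close>
    it inverts the shift, and its first letter is entry \<open>P - 1\<close>, the value chosen for
    \<open>g\<close>.\<close>
  define T :: "(nat \<Rightarrow> real) \<Rightarrow> nat \<Rightarrow> real" where "T = shift ^^ (P - 1)"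
  define g where "g x = (if x \<in> {1..n} then V x (P - 1) else 0)" for x
  let ?p = "inv (std n g)"
  have VinN: "V x \<in># N" if "x \<in> {1..n}" for x
    using that VN by (metis finite_atLeastAtMost finite_set_mset_mset_set imageI set_image_mset)
  have pin: "?p x \<in> {1..n}" if "x \<in> {1..n}" for x
    using that permutes_in_image[OF inv_std_permutes] by blast
  have shiftT: "shift (T U) = U" if "U \<in># N" for U
    using P that by (metis T_def Suc_diff_1 comp_apply funpow.simps(2))
  have T0: "T U 0 = U (P - 1)" for U by (simp add: T_def funpow_shift)
  have TN: "image_mset T N = N"
  proof -
    have "image_mset (shift ^^ k) N = N" for k
    proof (induction k)
      case (Suc k)
      have "image_mset (shift ^^ Suc k) N = image_mset shift (image_mset (shift ^^ k) N)"
        by (simp add: multiset.map_comp)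
      then show ?case by (simp only: Suc assms(2))
    qed simp
    then show ?thesis by (simp add: T_def)
  qed
  \<comment> \<open>Both sides are sorted enumerations of \<open>N\<close>. The left one is sorted
    because \<open>?p\<close> lists the positions by the prepended letter, ties in the original
    order. Applying the shift gives the recursion that identifies the cycle words with
    \<open>V\<close>.\<close>
  have TV: "T (V (?p x)) = V x" if "x \<in> {1..n}" for x
  proof (rule sorted_enumeration_unique[OF _ _ _ that])
    fix x y assume xy: "1 \<le> x" "x < y" "y \<le> n"
    then have x: "x \<in> {1..n}" and y: "y \<in> {1..n}" by auto
    have "g (?p x) < g (?p y) \<or> g (?p x) = g (?p y) \<and> ?p x < ?p y"
      using inv_std_less_iff[OF x y] xy by blast
    moreover have "?p x < ?p y \<Longrightarrow> lex_le (V (?p x)) (V (?p y))"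
      using V pin[OF x] pin[OF y] by auto
    ultimately have "T (V (?p x)) 0 < T (V (?p y)) 0 \<or>
        T (V (?p x)) 0 = T (V (?p y)) 0 \<and> lex_le (V (?p x)) (V (?p y))"
      using pin[OF x] pin[OF y] by (auto simp: g_def T0)
    then show "lex_le (T (V (?p x))) (T (V (?p y)))"
      by (rule lex_le_ConsI[rotated 2]) (use shiftT VinN pin x y in auto)
  next
    have "image_mset (\<lambda>x. T (V (?p x))) (mset_set {1..n}) = image_mset (\<lambda>x. T (V x)) (mset_set {1..n})"
      by (rule image_mset_permutes[where h="\<lambda>x. T (V x)", OF inv_std_permutes]) simp
    also have "\<dots> = image_mset T N" by (simp add: multiset.map_comp comp_def flip: VN)
    finally show "image_mset (\<lambda>x. T (V (?p x))) (mset_set {1..n}) = image_mset V (mset_set {1..n})"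
      by (simp only: TN VN)
  qed (use V in auto)
  have "cycle_word n g x = V x" if x: "x \<in> {1..n}" for x
  proof
    fix i
    have it: "V ((?p ^^ i) x) = (shift ^^ i) (V x)"
    proof (induction i)
      case (Suc i)
      have mem: "(?p ^^ i) x \<in> {1..n}" using x by (rule funpow_inv_std_in)
      then have "V (?p ((?p ^^ i) x)) = shift (V ((?p ^^ i) x))"
        using TV shiftT VinN pin by metis
      then show ?case by (simp add: Suc.IH)
    qed simp
    have mem: "(?p ^^ i) x \<in> {1..n}" using x by (rule funpow_inv_std_in)
    have "cycle_word n g x i = T (V (?p ((?p ^^ i) x))) 0"
      using pin[OF mem] by (simp add: cycle_word_def g_def T0)
    also have "\<dots> = V x i" by (simp add: TV[OF mem] it funpow_shift)
    finally show "cycle_word n g x i = V x i" .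
  qed
  then have "cycle_words n g = N"
    unfolding cycle_words_def VN[symmetric] by (intro image_mset_cong) auto
  moreover have "\<forall>x. x \<notin> {1..n} \<longrightarrow> g x = 0" by (simp add: g_def)
  ultimately show thesis using that by blast
qed

section \<open>Law of the multiset of words of a random sequence\<close>

definition cycle_words_pmf :: "real pmf \<Rightarrow> nat \<Rightarrow> (nat \<Rightarrow> real) multiset pmf" where
  "cycle_words_pmf p n = map_pmf (cycle_words n) (Pi_pmf {1..n} 0 (\<lambda>_. p))"

text \<open>The word at \<open>x\<close> starts with the letter at the preceding position, so the
  first letters of all words are the letters of \<open>g\<close>, permuted.\<close>

lemma prod_cycle_words: "(\<Prod>U\<in>#cycle_words n g. f (U 0)) = (\<Prod>x\<in>{1..n}. f (g x))"
proof -
  have "(\<Prod>U\<in>#cycle_words n g. f (U 0)) = (\<Prod>x\<in>{1..n}. f (g (inv (std n g) x)))"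
    by (simp add: cycle_words_def multiset.map_comp comp_def cycle_word_def prod_unfold_prod_mset)
  also have "\<dots> = (\<Prod>x\<in>{1..n}. f (g x))"
    using prod.permute[OF inv_std_permutes[of n g], of "\<lambda>x. f (g x)"] by (simp add: comp_def)
  finally show ?thesis .
qed

lemma pmf_cycle_words_pmf:
  "pmf (cycle_words_pmf p n) N =
    (if size N = n \<and> image_mset shift N = N then \<Prod>U\<in>#N. pmf p (U 0) else 0)"
proof (cases "size N = n \<and> image_mset shift N = N")
  case True
  let ?Q = "Pi_pmf {1..n} 0 (\<lambda>_. p)"
  obtain g where g: "\<forall>x. x \<notin> {1..n} \<longrightarrow> g x = 0" "cycle_words n g = N"
    using cycle_words_surj True by metis
  have "pmf (cycle_words_pmf p n) N = measure_pmf.prob ?Q (cycle_words n -` {N})"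
    by (simp add: cycle_words_pmf_def pmf_map)
  \<comment> \<open>Other sequences with this multiset are nonzero somewhere outside 1..n and hence
    carry no mass under \<open>?Q\<close>.\<close>
  also have "\<dots> = measure_pmf.prob ?Q {g}"
  proof (rule measure_prob_cong_0)
    fix h assume "h \<in> cycle_words n -` {N} - {g}"
    then have "\<not> (\<forall>x. x \<notin> {1..n} \<longrightarrow> h x = 0)"
      using g inj_on_cycle_words[of n] by (auto simp: inj_on_def)
    then show "pmf ?Q h = 0" by (intro pmf_Pi_outside) auto
  qed (use g in auto)
  also have "\<dots> = (\<Prod>x\<in>{1..n}. pmf p (g x))"
    unfolding measure_pmf_single using g(1) by (intro pmf_Pi') auto
  finally show ?thesis using True g(2) prod_cycle_words[of "pmf p" n g] by simp
next
  case False
  then have "N \<notin> set_pmf (cycle_words_pmf p n)"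
    by (auto simp: cycle_words_pmf_def size_cycle_words shift_cycle_words)
  then show ?thesis using False by (auto simp: pmf_eq_0_set_pmf)
qed

section \<open>Primitive words and their rotations\<close>

text \<open>A finite primitive word is represented by its infinite repetition. \<open>orbit\<close>
  starts at \<open>shift U\<close>, so the membership says that \<open>U\<close> is purely periodic;
  the cardinality is then its least period.\<close>

definition primitive :: "nat \<Rightarrow> (nat \<Rightarrow> 'a) \<Rightarrow> bool" where
  "primitive l U \<longleftrightarrow> U \<in> orbit shift U \<and> card (orbit shift U) = l"

abbreviation rotations :: "(nat \<Rightarrow> 'a) \<Rightarrow> (nat \<Rightarrow> 'a) multiset" where
  "rotations U \<equiv> mset_set (orbit shift U)"

lemma primitive_finite_orbit: "primitive l U \<Longrightarrow> finite (orbit shift U)"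
  by (simp add: primitive_def finite_orbit)

lemma primitive_pos: "primitive l U \<Longrightarrow> l > 0"
  using primitive_finite_orbit orbit_nonempty by (fastforce simp: primitive_def card_gt_0_iff)

lemma primitive_bij_betw:
  assumes "primitive l U"
  shows "bij_betw (\<lambda>i. (shift ^^ i) U) {..<l} (orbit shift U)" "(shift ^^ l) U = U"
proof -
  let ?d = "funpow_dist1 shift U U"
  have U: "U \<in> orbit shift U" "card (orbit shift U) = l" using assms by (auto simp: primitive_def)
  have "bij_betw (\<lambda>i. (shift ^^ i) U) {0..<?d} (orbit shift U)"
    using inj_on_funpow_dist1[OF U(1)] orbit_conv_funpow_dist1[OF U(1)] by (simp add: bij_betw_def)
  moreover from bij_betw_same_card[OF this] U(2) have "?d = l" by simp
  ultimately show "bij_betw (\<lambda>i. (shift ^^ i) U) {..<l} (orbit shift U)" "(shift ^^ l) U = U"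
    using funpow_dist1_prop[OF U(1)] by (simp_all add: atLeast0LessThan)
qed

lemma primitive_orbit:
  assumes "primitive l U" "V \<in> orbit shift U"
  shows "orbit shift V = orbit shift U" "primitive l V"
proof -
  have "U \<in> orbit shift U" using assms by (simp add: primitive_def)
  then have "U \<in> orbit shift V" using assms(2) by (rule orbit_swap)
  then show *: "orbit shift V = orbit shift U"
    using assms(2) by (auto intro: orbit_trans)
  show "primitive l V" using assms by (auto simp: primitive_def *)
qed

lemma shift_image_orbit:
  assumes "primitive l U"
  shows "shift ` orbit shift U = orbit shift U"
proof
  show "shift ` orbit shift U \<subseteq> orbit shift U" by (auto intro: orbit.step)
  show "orbit shift U \<subseteq> shift ` orbit shift U"
  proof
    fix V assume "V \<in> orbit shift U"
    then show "V \<in> shift ` orbit shift U"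
      by cases (use assms in \<open>auto simp: primitive_def\<close>)
  qed
qed

lemma shift_rotations:
  assumes "primitive l U"
  shows "image_mset shift (rotations U) = rotations U"
proof -
  have "inj_on shift (orbit shift U)"
    using shift_image_orbit[OF assms] primitive_finite_orbit[OF assms]
    by (simp add: eq_card_imp_inj_on)
  then show ?thesis by (simp add: image_mset_mset_set shift_image_orbit[OF assms])
qed

lemma size_rotations: "primitive l U \<Longrightarrow> size (rotations U) = l"
  by (simp add: primitive_def)

lemma primitive_self_in_rotations: "primitive l U \<Longrightarrow> U \<in># rotations U"
  by (simp add: primitive_finite_orbit) (simp add: primitive_def)

text \<open>Invariance carries membership along the orbit, and \<open>mset_set\<close> asks for
  multiplicity one only.\<close>

lemma rotations_subset:
  assumes "image_mset shift N = N" "U \<in># N"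
  shows "rotations U \<subseteq># N"
proof -
  have "V \<in># N" if "V \<in> orbit shift U" for V
    using that
  proof induction
    case base
    then show ?case using assms by (metis imageI set_image_mset)
  next
    case (step V)
    then show ?case using assms by (metis imageI set_image_mset)
  qed
  then have "orbit shift U \<subseteq> set_mset N" by blast
  then have "rotations U \<subseteq># mset_set (set_mset N)"
    by (intro subset_imp_msubset_mset_set) auto
  also have "\<dots> \<subseteq># N" by (rule mset_set_set_mset_msubset)
  finally show ?thesis .
qed

lemma bij_betw_add_rotations:
  assumes "primitive l U" "l \<le> n"
  shows "bij_betw (\<lambda>N. N + rotations U)
    {N. size N = n - l \<and> image_mset shift N = N} {N. size N = n \<and> image_mset shift N = N \<and> U \<in># N}"
proof (rule bij_betwI[where g="\<lambda>N. N - rotations U"])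
  show "(\<lambda>N. N + rotations U) \<in> {N. size N = n - l \<and> image_mset shift N = N} \<rightarrow>
      {N. size N = n \<and> image_mset shift N = N \<and> U \<in># N}"
    using assms size_rotations[OF assms(1)] shift_rotations[OF assms(1)]
      primitive_self_in_rotations[OF assms(1)] by auto
  show "(\<lambda>N. N - rotations U) \<in> {N. size N = n \<and> image_mset shift N = N \<and> U \<in># N} \<rightarrow>
      {N. size N = n - l \<and> image_mset shift N = N}"
  proof
    fix N assume N: "N \<in> {N. size N = n \<and> image_mset shift N = N \<and> U \<in># N}"
    then have "rotations U \<subseteq># N" using rotations_subset by blast
    then show "N - rotations U \<in> {N. size N = n - l \<and> image_mset shift N = N}"
      using N size_rotations[OF assms(1)] shift_rotations[OF assms(1)]
      by (simp add: size_Diff_submset image_mset_Diff del: size_mset_set)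
  qed
qed (use rotations_subset in \<open>auto intro!: subset_mset.diff_add\<close>)

section \<open>Random periodic words and the effect of deleting an orbit\<close>

definition periodic_word_pmf :: "'a pmf \<Rightarrow> nat \<Rightarrow> (nat \<Rightarrow> 'a) pmf" where
  "periodic_word_pmf p l = map_pmf (\<lambda>u i. u (i mod l)) (Pi_pmf {..<l} undefined (\<lambda>_. p))"

lemma pmf_periodic_word_pmf:
  assumes "(shift ^^ l) U = U" "l > 0"
  shows "pmf (periodic_word_pmf p l) U = (\<Prod>i<l. pmf p (U i))"
proof -
  let ?Q = "Pi_pmf {..<l} undefined (\<lambda>_. p)"
  define u where "u i = (if i < l then U i else undefined)" for i
  have per: "U (i mod l) = U i" for i
    using funpow_mod_eq[OF assms(1), of i] by (metis add_0 funpow_shift)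
  have "pmf (periodic_word_pmf p l) U = measure_pmf.prob ?Q ((\<lambda>u i. u (i mod l)) -` {U})"
    by (simp add: periodic_word_pmf_def pmf_map)
  also have "\<dots> = measure_pmf.prob ?Q {u}"
  proof (rule measure_prob_cong_0)
    fix v assume v: "v \<in> (\<lambda>u i. u (i mod l)) -` {U} - {u}"
    have "v i = U i" if "i < l" for i
      using v that by (metis DiffD1 mod_less singletonD vimageD)
    with v have "\<not> (\<forall>i. i \<notin> {..<l} \<longrightarrow> v i = undefined)"
      by (auto simp: u_def fun_eq_iff split: if_splits)
    then show "pmf ?Q v = 0" by (intro pmf_Pi_outside) auto
  qed (use assms(2) in \<open>auto simp: u_def per\<close>)
  also have "\<dots> = (\<Prod>i<l. pmf p (u i))"
    unfolding measure_pmf_single by (rule pmf_Pi') (auto simp: u_def)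
  finally show ?thesis by (simp add: u_def)
qed

text \<open>The first letters of the l rotations form one period of \<open>U\<close>, so the weight
  gained by adding them is the probability of drawing \<open>U\<close> as a random word of length
  l.\<close>

lemma prod_rotations:
  assumes "primitive l U"
  shows "(\<Prod>V\<in>#rotations U. pmf p (V 0)) = pmf (periodic_word_pmf p l) U"
proof -
  have "(\<Prod>V\<in>#rotations U. pmf p (V 0)) = (\<Prod>V\<in>orbit shift U. pmf p (V 0))"
    by (simp add: prod_unfold_prod_mset)
  also have "\<dots> = (\<Prod>i<l. pmf p (((shift ^^ i) U) 0))"
    by (rule prod.reindex_bij_betw[OF primitive_bij_betw(1)[OF assms], symmetric])
  finally show ?thesis
    using pmf_periodic_word_pmf[OF primitive_bij_betw(2)[OF assms] primitive_pos[OF assms]]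
    by (simp add: funpow_shift)
qed

text \<open>Deleting the rotations of \<open>U\<close> from a multiset containing \<open>U\<close> leaves an
  arbitrary multiset of smaller size, and the weights are multiplicative.\<close>

lemma nn_integral_contains_primitive:
  fixes f :: "(nat \<Rightarrow> real) multiset \<Rightarrow> ennreal"
  assumes "primitive l U" "l \<le> n"
  shows "(\<integral>\<^sup>+N. (if U \<in># N then f N else 0) \<partial>cycle_words_pmf p n) =
    ennreal (pmf (periodic_word_pmf p l) U) * (\<integral>\<^sup>+N. f (N + rotations U) \<partial>cycle_words_pmf p (n - l))"
proof -
  let ?A = "{N. size N = n - l \<and> image_mset shift N = N}"
  let ?B = "{N. size N = n \<and> image_mset shift N = N \<and> U \<in># N}"
  have "(\<integral>\<^sup>+N. (if U \<in># N then f N else 0) \<partial>cycle_words_pmf p n) =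
      (\<integral>\<^sup>+N. ennreal (pmf (cycle_words_pmf p n) N) * (if U \<in># N then f N else 0) \<partial>count_space ?B)"
    unfolding nn_integral_measure_pmf
    by (rule nn_integral_count_space_eq) (auto simp: pmf_cycle_words_pmf)
  also have "\<dots> = (\<integral>\<^sup>+N. ennreal (pmf (cycle_words_pmf p n) (N + rotations U)) *
      (if U \<in># N + rotations U then f (N + rotations U) else 0) \<partial>count_space ?A)"
    by (rule nn_integral_bij_count_space[OF bij_betw_add_rotations[OF assms], symmetric])
  also have "\<dots> = (\<integral>\<^sup>+N. ennreal (pmf (periodic_word_pmf p l) U) *
      (ennreal (pmf (cycle_words_pmf p (n - l)) N) * f (N + rotations U)) \<partial>count_space ?A)"
  proof (rule nn_integral_cong)
    fix N :: "(nat \<Rightarrow> real) multiset" assume "N \<in> space (count_space ?A)"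
    then have N: "N \<in> ?A" by simp
    then have "N + rotations U \<in> ?B"
      using bij_betwE[OF bij_betw_add_rotations[OF assms]] by blast
    then have "U \<in># N + rotations U" "pmf (cycle_words_pmf p n) (N + rotations U) =
        pmf (periodic_word_pmf p l) U * pmf (cycle_words_pmf p (n - l)) N"
      using N prod_rotations[OF assms(1), of p] by (simp_all add: pmf_cycle_words_pmf del: size_mset_set)
    then show "ennreal (pmf (cycle_words_pmf p n) (N + rotations U)) *
      (if U \<in># N + rotations U then f (N + rotations U) else 0) = ennreal (pmf (periodic_word_pmf p l) U) *
      (ennreal (pmf (cycle_words_pmf p (n - l)) N) * f (N + rotations U))"
      by (simp add: ennreal_mult mult.assoc)
  qed
  also have "\<dots> = ennreal (pmf (periodic_word_pmf p l) U) *
      (\<integral>\<^sup>+N. ennreal (pmf (cycle_words_pmf p (n - l)) N) * f (N + rotations U) \<partial>count_space ?A)"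
    by (rule nn_integral_cmult) simp
  also have "(\<integral>\<^sup>+N. ennreal (pmf (cycle_words_pmf p (n - l)) N) * f (N + rotations U) \<partial>count_space ?A) =
      (\<integral>\<^sup>+N. f (N + rotations U) \<partial>cycle_words_pmf p (n - l))"
    unfolding nn_integral_measure_pmf
    by (rule nn_integral_count_space_eq) (auto simp: pmf_cycle_words_pmf)
  finally show ?thesis .
qed

lemma set_cycle_words_pmf:
  "N \<in> set_pmf (cycle_words_pmf p n) \<Longrightarrow> size N = n \<and> image_mset shift N = N"
  by (auto simp: cycle_words_pmf_def size_cycle_words shift_cycle_words)

lemma primitive_length_le:
  assumes "N \<in> set_pmf (cycle_words_pmf p n)" "primitive l U" "U \<in># N"
  shows "l \<le> n"
  using size_mset_mono[OF rotations_subset[of N U]] set_cycle_words_pmf[OF assms(1)] assms(2,3)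
  by (simp add: primitive_def)

text \<open>A Mecke-type formula: a word picked from the multiset can be replaced by a random
  periodic word whose rotations are added to an independent smaller multiset. It is Tonelli for
  counting measures combined with \<open>nn_integral_contains_primitive\<close>; values in
  \<open>ennreal\<close> avoid integrability conditions.\<close>

lemma nn_integral_sum_primitive:
  fixes f :: "(nat \<Rightarrow> real) \<Rightarrow> (nat \<Rightarrow> real) multiset \<Rightarrow> ennreal"
  assumes "l \<le> n"
  shows "(\<integral>\<^sup>+N. (\<Sum>U | U \<in># N \<and> primitive l U. f U N) \<partial>cycle_words_pmf p n) =
    (\<integral>\<^sup>+U. (if primitive l U then \<integral>\<^sup>+N. f U (N + rotations U) \<partial>cycle_words_pmf p (n - l) else 0)
      \<partial>periodic_word_pmf p l)"
proof -
  \<comment> \<open>Extension by zero, so that the words and the multisets range over fixed spaces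
    and the integrals can be exchanged.\<close>
  let ?g = "\<lambda>N U. if U \<in># N \<and> primitive l U then f U N else 0"
  have "(\<integral>\<^sup>+N. (\<Sum>U | U \<in># N \<and> primitive l U. f U N) \<partial>cycle_words_pmf p n) =
      (\<integral>\<^sup>+N. (\<integral>\<^sup>+U. ennreal (pmf (cycle_words_pmf p n) N) * ?g N U \<partial>count_space UNIV) \<partial>count_space UNIV)"
    unfolding nn_integral_measure_pmf
  proof (rule nn_integral_cong)
    fix N
    have "(\<integral>\<^sup>+U. ?g N U \<partial>count_space UNIV) = (\<integral>\<^sup>+U. f U N \<partial>count_space {U. U \<in># N \<and> primitive l U})"
      by (subst nn_integral_count_space_eq[where B="{U. U \<in># N \<and> primitive l U}"])
        (auto intro!: nn_integral_cong)
    also have "\<dots> = (\<Sum>U | U \<in># N \<and> primitive l U. f U N)"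
      by (rule nn_integral_count_space_finite) simp
    finally show "ennreal (pmf (cycle_words_pmf p n) N) * (\<Sum>U | U \<in># N \<and> primitive l U. f U N) =
        (\<integral>\<^sup>+U. ennreal (pmf (cycle_words_pmf p n) N) * ?g N U \<partial>count_space UNIV)"
      by (simp add: nn_integral_cmult)
  qed
  also have "\<dots> = (\<integral>\<^sup>+U. (\<integral>\<^sup>+N. ennreal (pmf (cycle_words_pmf p n) N) * ?g N U \<partial>count_space UNIV) \<partial>count_space UNIV)"
    using nn_integral_fst_count_space[of "\<lambda>(N, U). ennreal (pmf (cycle_words_pmf p n) N) * ?g N U"]
      nn_integral_snd_count_space[of "\<lambda>(N, U). ennreal (pmf (cycle_words_pmf p n) N) * ?g N U"] by simp
  also have "\<dots> = (\<integral>\<^sup>+U. ennreal (pmf (periodic_word_pmf p l) U) *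
      (if primitive l U then \<integral>\<^sup>+N. f U (N + rotations U) \<partial>cycle_words_pmf p (n - l) else 0)
      \<partial>count_space UNIV)"
  proof (rule nn_integral_cong)
    fix U
    have "(\<integral>\<^sup>+N. ennreal (pmf (cycle_words_pmf p n) N) * ?g N U \<partial>count_space UNIV) =
        (\<integral>\<^sup>+N. ?g N U \<partial>cycle_words_pmf p n)"
      by (rule nn_integral_measure_pmf[symmetric])
    also have "\<dots> = ennreal (pmf (periodic_word_pmf p l) U) *
      (if primitive l U then \<integral>\<^sup>+N. f U (N + rotations U) \<partial>cycle_words_pmf p (n - l) else 0)"
      using nn_integral_contains_primitive[where f="f U" and U=U and p=p, OF _ assms] by (cases "primitive l U") auto
    finally show "(\<integral>\<^sup>+N. ennreal (pmf (cycle_words_pmf p n) N) * ?g N U \<partial>count_space UNIV) =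
      ennreal (pmf (periodic_word_pmf p l) U) *
      (if primitive l U then \<integral>\<^sup>+N. f U (N + rotations U) \<partial>cycle_words_pmf p (n - l) else 0)" .
  qed
  finally show ?thesis by (simp only: nn_integral_measure_pmf)
qed

section \<open>Repeated words and the recursion for cycle counts\<close>

lemma pmf_bound_nonneg:
  assumes "\<And>a. pmf p a \<le> \<epsilon>"
  shows "0 \<le> \<epsilon>"
  using pmf_nonneg assms by (rule order_trans)

lemma pmf_periodic_word_le:
  assumes "\<And>a. pmf p a \<le> \<epsilon>" "primitive l U"
  shows "pmf (periodic_word_pmf p l) U \<le> \<epsilon>"
proof -
  obtain l' where l: "l = Suc l'" using primitive_pos[OF assms(2)] gr0_conv_Suc by blast
  have "pmf (periodic_word_pmf p l) U = (\<Prod>i<l. pmf p (U i))"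
    using primitive_bij_betw(2)[OF assms(2)] primitive_pos[OF assms(2)] by (rule pmf_periodic_word_pmf)
  also have "\<dots> = pmf p (U 0) * (\<Prod>i<l'. pmf p (U (Suc i)))"
    unfolding l by (rule prod.lessThan_Suc_shift)
  also have "\<dots> \<le> pmf p (U 0) * 1"
    by (intro mult_left_mono prod_le_1) (simp_all add: pmf_le_1)
  finally show ?thesis using assms(1)[of "U 0"] by simp
qed

text \<open>Given the letter \<open>a\<close> at \<open>j\<close>, the independent letter at
  \<open>i\<close> hits it with probability \<open>pmf p a\<close>.\<close>

lemma measure_Pi_pmf_eq_le:
  assumes "\<And>a. pmf p a \<le> \<epsilon>" "finite A" "i \<in> A" "j \<in> A" "i \<noteq> j"
  shows "measure_pmf.prob (Pi_pmf A d (\<lambda>_. p)) {u. u i = u j} \<le> \<epsilon>"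
proof -
  let ?Q = "Pi_pmf (A - {j}) d (\<lambda>_. p)"
  have e: "0 \<le> \<epsilon>" using assms(1) by (rule pmf_bound_nonneg)
  have "Pi_pmf A d (\<lambda>_. p) = Pi_pmf (insert j (A - {j})) d (\<lambda>_. p)"
    using assms(4) by (simp add: insert_absorb)
  also have "\<dots> = map_pmf (\<lambda>(y, f). f(j := y)) (pair_pmf p ?Q)"
    using assms(2) by (subst Pi_pmf_insert) auto
  finally have "emeasure (Pi_pmf A d (\<lambda>_. p)) {u. u i = u j} =
      (\<integral>\<^sup>+a. \<integral>\<^sup>+f. indicator {f. f i = a} f \<partial>?Q \<partial>p)"
    using assms(5)
    by (simp add: nn_integral_pair_pmf' flip: nn_integral_indicator) (simp add: indicator_def)
  also have "\<dots> = (\<integral>\<^sup>+a. ennreal (pmf p a) \<partial>p)"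
  proof (rule nn_integral_cong)
    fix a
    have "(\<integral>\<^sup>+f. indicator {f. f i = a} f \<partial>?Q) = emeasure ?Q ((\<lambda>f. f i) -` {a})"
      by (simp add: vimage_def)
    also have "\<dots> = ennreal (pmf (map_pmf (\<lambda>f. f i) ?Q) a)"
      by (simp add: pmf_map measure_pmf.emeasure_eq_measure)
    also have "map_pmf (\<lambda>f. f i) ?Q = p"
      using assms(2,3,5) by (subst Pi_pmf_component) auto
    finally show "(\<integral>\<^sup>+f. indicator {f. f i = a} f \<partial>?Q) = ennreal (pmf p a)" .
  qed
  also have "\<dots> \<le> (\<integral>\<^sup>+a. ennreal \<epsilon> \<partial>p)"
    by (intro nn_integral_mono ennreal_leI assms(1))
  also have "\<dots> = ennreal \<epsilon>" by simp
  finally show ?thesis using e by (simp add: measure_pmf.emeasure_eq_measure)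
qed

text \<open>If the l rotations are not distinct, comparing the first letters of two equal ones gives
  equal letters at two positions of the word. The constant is the union bound over at most l^2 pairs
  of positions.\<close>

lemma measure_not_primitive_le:
  assumes "\<And>a. pmf p a \<le> \<epsilon>" "l > 0"
  shows "measure_pmf.prob (periodic_word_pmf p l) {U. \<not> primitive l U} \<le> real l ^ 2 * \<epsilon>"
proof -
  let ?Q = "Pi_pmf {..<l} undefined (\<lambda>_. p)"
  let ?I = "{(i, j). i < l \<and> j < l \<and> i \<noteq> j}"
  have e: "0 \<le> \<epsilon>" using assms(1) by (rule pmf_bound_nonneg)
  have sub: "?I \<subseteq> {..<l} \<times> {..<l}" by auto
  then have fin: "finite ?I" by (rule finite_subset) simp
  have "u \<in> (\<Union>(i, j)\<in>?I. {u. u i = u j})" if np: "\<not> primitive l (\<lambda>i. u (i mod l))" for u :: "nat \<Rightarrow> 'a"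
  proof -
    let ?U = "\<lambda>i. u (i mod l)"
    have per: "(shift ^^ l) ?U = ?U" by (simp add: funpow_shift fun_eq_iff)
    then have "?U \<in> orbit shift ?U" using assms(2) by (auto simp: orbit_altdef intro!: exI[of _ l])
    then have "card (orbit shift ?U) \<noteq> l" using np by (simp add: primitive_def)
    moreover have "orbit shift ?U = (\<lambda>i. (shift ^^ i) ?U) ` {..<l}"
      using orbit_altdef_bounded[OF per assms(2)] by auto
    ultimately have "\<not> inj_on (\<lambda>i. (shift ^^ i) ?U) {..<l}"
      by (metis card_image card_lessThan)
    then obtain i j where ij: "i < l" "j < l" "i \<noteq> j" "(shift ^^ i) ?U = (shift ^^ j) ?U"
      by (auto simp: inj_on_def)
    then have "(shift ^^ i) ?U 0 = (shift ^^ j) ?U 0" by simp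
    then have "u i = u j" using ij(1,2) by (simp add: funpow_shift)
    with ij(1-3) show ?thesis by blast
  qed
  then have "measure_pmf.prob (periodic_word_pmf p l) {U. \<not> primitive l U} \<le>
      measure_pmf.prob ?Q (\<Union>(i, j)\<in>?I. {u. u i = u j})"
    unfolding periodic_word_pmf_def by (simp, intro measure_pmf.finite_measure_mono) auto
  also have "\<dots> \<le> (\<Sum>(i, j)\<in>?I. measure_pmf.prob ?Q {u. u i = u j})"
    using measure_pmf.finite_measure_subadditive_finite[OF fin, of "\<lambda>(i, j). {u. u i = u j}" ?Q]
    by (simp add: case_prod_unfold)
  also have "\<dots> \<le> (\<Sum>(i, j)\<in>?I. \<epsilon>)"
    by (intro sum_mono) (auto intro!: measure_Pi_pmf_eq_le[OF assms(1)])
  also have "\<dots> = card ?I * \<epsilon>" by simp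
  also have "\<dots> \<le> real l ^ 2 * \<epsilon>"
    using card_mono[OF _ sub] e
    by (intro mult_right_mono) (simp_all add: power2_eq_square flip: of_nat_mult)
  finally show ?thesis .
qed

lemma emeasure_contains_le:
  assumes "\<And>a. pmf p a \<le> \<epsilon>" "primitive l U"
  shows "emeasure (cycle_words_pmf p n) {N. U \<in># N} \<le> ennreal \<epsilon>"
proof (cases "l \<le> n")
  case True
  have "emeasure (cycle_words_pmf p n) {N. U \<in># N} =
      (\<integral>\<^sup>+N. indicator {N. U \<in># N} N \<partial>cycle_words_pmf p n)" by simp
  also have "\<dots> = (\<integral>\<^sup>+N. (if U \<in># N then 1 else 0) \<partial>cycle_words_pmf p n)"
    by (rule nn_integral_cong) (simp add: indicator_def)
  also have "\<dots> = ennreal (pmf (periodic_word_pmf p l) U)"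
    using nn_integral_contains_primitive[where f="\<lambda>_. 1" and p=p, OF assms(2) True] by simp
  finally show ?thesis using pmf_periodic_word_le[OF assms] by (simp add: ennreal_leI)
next
  case False
  then have "AE N in cycle_words_pmf p n. \<not> U \<in># N"
    using primitive_length_le[OF _ assms(2)] by (auto simp: AE_measure_pmf_iff)
  from emeasure_eq_0_AE[OF this] have "emeasure (cycle_words_pmf p n) {N. U \<in># N} = 0" by simp
  then show ?thesis by simp
qed

text \<open>A word that occurs twice is still present after its rotations have been deleted once.
  The integral formula therefore bounds the probability by that of a prescribed word occurring in a
  smaller multiset.\<close>

lemma emeasure_double_le:
  assumes "\<And>a. pmf p a \<le> \<epsilon>"
  shows "emeasure (cycle_words_pmf p n) {N. \<exists>U. primitive l U \<and> count N U \<ge> 2} \<le> ennreal \<epsilon>"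
proof (cases "l \<le> n")
  case True
  have *: "indicator {N. \<exists>U. primitive l U \<and> count N U \<ge> 2} N \<le>
      (\<Sum>U | U \<in># N \<and> primitive l U. indicator {N. count N U \<ge> 2} N :: ennreal)" for N
  proof (cases "\<exists>U. primitive l U \<and> count N U \<ge> 2")
    case True
    then obtain U where U: "primitive l U" "count N U \<ge> 2" by blast
    then have "U \<in> {U. U \<in># N \<and> primitive l U}" using count_eq_zero_iff[of N U] by auto
    then have "indicator {N. count N U \<ge> 2} N \<le>
      (\<Sum>U | U \<in># N \<and> primitive l U. indicator {N. count N U \<ge> 2} N :: ennreal)"
      by (intro member_le_sum) auto
    then show ?thesis using U by (auto simp: indicator_def)
  qed (auto simp: indicator_def)
  have "emeasure (cycle_words_pmf p n) {N. \<exists>U. primitive l U \<and> count N U \<ge> 2} \<le>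
      (\<integral>\<^sup>+N. (\<Sum>U | U \<in># N \<and> primitive l U. indicator {N. count N U \<ge> 2} N) \<partial>cycle_words_pmf p n)"
    by (subst nn_integral_indicator[symmetric]) (simp, intro nn_integral_mono *)
  also have "\<dots> = (\<integral>\<^sup>+U. (if primitive l U then \<integral>\<^sup>+N. indicator {N. count N U \<ge> 2} (N + rotations U)
      \<partial>cycle_words_pmf p (n - l) else 0) \<partial>periodic_word_pmf p l)"
    by (rule nn_integral_sum_primitive[OF True])
  also have "\<dots> \<le> (\<integral>\<^sup>+U. ennreal \<epsilon> \<partial>periodic_word_pmf p l)"
  proof (rule nn_integral_mono)
    fix U
    have "(\<integral>\<^sup>+N. indicator {N. count N U \<ge> 2} (N + rotations U) \<partial>cycle_words_pmf p (n - l)) \<le> ennreal \<epsilon>"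
      if U: "primitive l U"
    proof -
      \<comment> \<open>The added rotations supply one copy, so multiplicity at least 2 in the sum
        means that \<open>U\<close> was there before.\<close>
      have "count (rotations U) U = 1"
        using U primitive_finite_orbit[OF U] by (simp add: primitive_def count_mset_set)
      then have "(\<integral>\<^sup>+N. indicator {N. count N U \<ge> 2} (N + rotations U) \<partial>cycle_words_pmf p (n - l)) =
          (\<integral>\<^sup>+N. indicator {N. U \<in># N} N \<partial>cycle_words_pmf p (n - l))"
        by (intro nn_integral_cong) (auto simp: indicator_def not_in_iff)
      also have "\<dots> \<le> ennreal \<epsilon>" using emeasure_contains_le[OF assms U] by simp
      finally show ?thesis .
    qed
    then show "(if primitive l U then \<integral>\<^sup>+N. indicator {N. count N U \<ge> 2} (N + rotations U)
      \<partial>cycle_words_pmf p (n - l) else 0) \<le> ennreal \<epsilon>" by simp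
  qed
  finally show ?thesis by simp
next
  case False
  then have "AE N in cycle_words_pmf p n. \<not> (\<exists>U. primitive l U \<and> count N U \<ge> 2)"
    unfolding AE_measure_pmf_iff
    by (metis primitive_length_le count_eq_zero_iff not_numeral_le_zero)
  from emeasure_eq_0_AE[OF this] have "emeasure (cycle_words_pmf p n) {N. \<exists>U. primitive l U \<and> count N U \<ge> 2} = 0" by simp
  then show ?thesis by simp
qed

section \<open>Recursion for the joint law of the cycle counts\<close>

definition size_primitive :: "nat \<Rightarrow> (nat \<Rightarrow> real) multiset \<Rightarrow> nat" where
  "size_primitive l N = size (filter_mset (primitive l) N)"

lemma primitive_unique: "primitive l U \<Longrightarrow> primitive j U \<longleftrightarrow> j = l"
  by (auto simp: primitive_def)

lemma size_primitive_add_rotations: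
  assumes "primitive l U"
  shows "size_primitive j (N + rotations U) = size_primitive j N + (if j = l then l else 0)"
proof -
  have "filter_mset (primitive j) (rotations U) = (if j = l then rotations U else {#})"
  proof -
    have "{V \<in> orbit shift U. primitive j V} = (if j = l then orbit shift U else {})"
      using primitive_orbit(2)[OF assms] primitive_unique[of l _ j] by auto
    then show ?thesis using primitive_finite_orbit[OF assms] by simp
  qed
  then show ?thesis using size_rotations[OF assms] by (simp add: size_primitive_def)
qed

text \<open>For an invariant multiset, \<open>size_primitive l\<close> is \<open>l\<close> times the number of cycles of length
  \<open>l\<close>, hence the factor below.\<close>

definition counts_event :: "nat \<Rightarrow> (nat \<Rightarrow> nat) \<Rightarrow> (nat \<Rightarrow> real) multiset set" where
  "counts_event k m = {N. \<forall>j\<in>{1..k}. size_primitive j N = j * m j}"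

lemma counts_event_add_rotations:
  assumes "primitive l U" "l \<in> {1..k}" "m l > 0"
  shows "N + rotations U \<in> counts_event k m \<longleftrightarrow> N \<in> counts_event k (m(l := m l - 1))"
  unfolding counts_event_def mem_Collect_eq
proof (rule ball_cong)
  fix j
  have "l * m l = l * (m l - 1) + l" using assms(3) by (cases "m l") auto
  then show "size_primitive j (N + rotations U) = j * m j \<longleftrightarrow>
      size_primitive j N = j * (m(l := m l - 1)) j"
    by (auto simp: size_primitive_add_rotations[OF assms(1)])
qed simp

text \<open>Approximates the identity \<open>l * m l * P m = P (m(l := m l - 1))\<close>, which is
  satisfied by independent Poisson variables with parameters 1/l. The first error term accounts for
  words of multiplicity at least 2, the second for random words that are not primitive.\<close>

lemma counts_event_recursion:
  assumes "\<And>a. pmf p a \<le> \<epsilon>" "l \<in> {1..k}" "m l > 0" "l \<le> n"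
  shows "\<bar>real (l * m l) * measure_pmf.prob (cycle_words_pmf p n) (counts_event k m) -
      measure_pmf.prob (cycle_words_pmf p (n - l)) (counts_event k (m(l := m l - 1)))\<bar> \<le>
    real (l * m l) * \<epsilon> + real l ^ 2 * \<epsilon>"
proof -
  let ?\<mu> = "cycle_words_pmf p n" and ?E = "counts_event k m"
  let ?q = "measure_pmf.prob ?\<mu> ?E" and ?c = "real (l * m l)"
  let ?q' = "measure_pmf.prob (cycle_words_pmf p (n - l)) (counts_event k (m(l := m l - 1)))"
  let ?w = "measure_pmf.prob (periodic_word_pmf p l) {U. primitive l U}"
  let ?D = "{N. \<exists>U. primitive l U \<and> count N U \<ge> 2}"
  have e: "0 \<le> \<epsilon>" using assms(1) by (rule pmf_bound_nonneg)
  have "(\<integral>\<^sup>+N. (\<Sum>U | U \<in># N \<and> primitive l U. indicator ?E N) \<partial>?\<mu>) =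
    (\<integral>\<^sup>+U. (if primitive l U then \<integral>\<^sup>+N. indicator ?E (N + rotations U) \<partial>cycle_words_pmf p (n - l) else 0)
      \<partial>periodic_word_pmf p l)"
    by (rule nn_integral_sum_primitive[OF assms(4)])
  also have "\<dots> = (\<integral>\<^sup>+U. ennreal ?q' * indicator {U. primitive l U} U \<partial>periodic_word_pmf p l)"
  proof (rule nn_integral_cong)
    fix U
    have "(\<integral>\<^sup>+N. indicator ?E (N + rotations U) \<partial>cycle_words_pmf p (n - l)) = ennreal ?q'"
      if "primitive l U"
    proof -
      have "(\<integral>\<^sup>+N. indicator ?E (N + rotations U) \<partial>cycle_words_pmf p (n - l)) =
          (\<integral>\<^sup>+N. indicator (counts_event k (m(l := m l - 1))) N \<partial>cycle_words_pmf p (n - l))"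
        using counts_event_add_rotations[OF that assms(2), of m] assms(3)
        by (intro nn_integral_cong) (auto simp: indicator_def)
      then show ?thesis by (simp add: measure_pmf.emeasure_eq_measure)
    qed
    then show "(if primitive l U then \<integral>\<^sup>+N. indicator ?E (N + rotations U) \<partial>cycle_words_pmf p (n - l) else 0)
      = ennreal ?q' * indicator {U. primitive l U} U" by simp
  qed
  also have "\<dots> = ennreal (?w * ?q')"
    by (subst nn_integral_cmult_indicator)
      (simp_all add: measure_pmf.emeasure_eq_measure mult.commute flip: ennreal_mult)
  finally have A: "(\<integral>\<^sup>+N. (\<Sum>U | U \<in># N \<and> primitive l U. indicator ?E N) \<partial>?\<mu>) = ennreal (?w * ?q')" .
  have sz: "size_primitive l N = (\<Sum>U | U \<in># N \<and> primitive l U. count N U)" for N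
    by (simp add: size_primitive_def size_multiset_overloaded_eq)
  \<comment> \<open>The integral formula sees each distinct word once, whereas \<open>?c\<close>
    counts with multiplicity; hence only an upper bound in general.\<close>
  have up: "real (card {U. U \<in># N \<and> primitive l U}) \<le> ?c" if "N \<in> ?E" for N
  proof -
    have "card {U. U \<in># N \<and> primitive l U} = (\<Sum>U | U \<in># N \<and> primitive l U. 1)" by simp
    also have "\<dots> \<le> (\<Sum>U | U \<in># N \<and> primitive l U. count N U)"
      by (rule sum_mono) (simp add: Suc_le_eq)
    also have "\<dots> = l * m l" using that assms(2) by (simp add: counts_event_def flip: sz)
    finally show ?thesis by (rule of_nat_mono)
  qed
  \<comment> \<open>Off the event \<open>?D\<close> all multiplicities are 1 and the two ways of
    counting agree.\<close>
  have low: "?c = real (card {U. U \<in># N \<and> primitive l U})" if "N \<in> ?E" "N \<notin> ?D" for N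
  proof -
    have "l * m l = (\<Sum>U | U \<in># N \<and> primitive l U. count N U)"
      using that assms(2) by (simp add: counts_event_def flip: sz)
    also have "\<dots> = (\<Sum>U | U \<in># N \<and> primitive l U. 1)"
    proof (rule sum.cong)
      fix U assume "U \<in> {U. U \<in># N \<and> primitive l U}"
      then have "count N U > 0" "\<not> count N U \<ge> 2" using that by auto
      then show "count N U = 1" by linarith
    qed simp
    finally show ?thesis by simp
  qed
  have "ennreal (?w * ?q') \<le> (\<integral>\<^sup>+N. ennreal ?c * indicator ?E N \<partial>?\<mu>)"
    unfolding A[symmetric]
  proof (rule nn_integral_mono)
    fix N
    show "(\<Sum>U | U \<in># N \<and> primitive l U. indicator ?E N) \<le> ennreal ?c * indicator ?E N"
      using up[of N] by (cases "N \<in> ?E") (simp_all add: ennreal_of_nat_eq_real_of_nat ennreal_leI del: of_nat_mult)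
  qed
  also have "\<dots> = ennreal (?c * ?q)"
    by (simp add: nn_integral_cmult_indicator measure_pmf.emeasure_eq_measure ennreal_mult)
  finally have 1: "?w * ?q' \<le> ?c * ?q" by (simp add: ennreal_le_iff)
  have "ennreal (?c * ?q) = (\<integral>\<^sup>+N. ennreal ?c * indicator ?E N \<partial>?\<mu>)"
    by (simp add: nn_integral_cmult_indicator measure_pmf.emeasure_eq_measure ennreal_mult)
  \<comment> \<open>On \<open>?D\<close> the sum over distinct words may fall short, and the second
    summand pays for the whole of \<open>?c\<close>.\<close>
  also have "\<dots> \<le> (\<integral>\<^sup>+N. (\<Sum>U | U \<in># N \<and> primitive l U. indicator ?E N) + ennreal ?c * indicator ?D N \<partial>?\<mu>)"
  proof (rule nn_integral_mono)
    fix N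
    show "ennreal ?c * indicator ?E N \<le>
        (\<Sum>U | U \<in># N \<and> primitive l U. indicator ?E N) + ennreal ?c * indicator ?D N"
      using low[of N] by (cases "N \<in> ?E"; cases "N \<in> ?D")
        (simp_all add: ennreal_of_nat_eq_real_of_nat del: of_nat_mult)
  qed
  also have "\<dots> = (\<integral>\<^sup>+N. (\<Sum>U | U \<in># N \<and> primitive l U. indicator ?E N) \<partial>?\<mu>) +
      (\<integral>\<^sup>+N. ennreal ?c * indicator ?D N \<partial>?\<mu>)"
    by (rule nn_integral_add) simp_all
  also have "\<dots> = ennreal (?w * ?q') + ennreal ?c * emeasure ?\<mu> ?D"
    unfolding A by (subst nn_integral_cmult_indicator) simp_all
  also have "\<dots> \<le> ennreal (?w * ?q') + ennreal ?c * ennreal \<epsilon>"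
    by (intro add_left_mono mult_left_mono emeasure_double_le assms(1)) simp
  also have "\<dots> = ennreal (?w * ?q' + ?c * \<epsilon>)"
    using e by (simp add: ennreal_mult ennreal_plus)
  finally have 2: "?c * ?q \<le> ?w * ?q' + ?c * \<epsilon>" using e by (subst (asm) ennreal_le_iff) auto
  have "1 - ?w \<le> real l ^ 2 * \<epsilon>"
    using measure_not_primitive_le[OF assms(1), of l] assms(2)
      measure_pmf.prob_compl[of "{U. primitive l U}" "periodic_word_pmf p l"]
    by (simp add: Compl_eq[symmetric] Compl_eq_Diff_UNIV[symmetric] Collect_neg_eq)
  moreover have "?q' * (1 - ?w) \<le> 1 * (1 - ?w)" "?w * ?q' \<le> 1 * ?q'"
    by (intro mult_right_mono; simp)+
  ultimately have "?q' - ?w * ?q' \<le> real l ^ 2 * \<epsilon>" "?w * ?q' \<le> ?q'" by (simp_all add: algebra_simps)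
  then show ?thesis using 1 2 e by (simp only: abs_le_iff) (auto intro: add_increasing)
qed

section \<open>Binomial moments of the number of short necklaces\<close>

definition short :: "nat \<Rightarrow> (nat \<Rightarrow> real) \<Rightarrow> bool" where
  "short k U \<longleftrightarrow> (\<exists>l\<in>{1..k}. primitive l U)"

text \<open>A necklace is the orbit of a word. Repeated occurrences are counted once, unlike in
  \<open>size_primitive\<close>, to fit sums over the distinct words of \<open>N\<close>.\<close>

definition necklace_count :: "nat \<Rightarrow> (nat \<Rightarrow> real) multiset \<Rightarrow> nat" where
  "necklace_count k N = card (orbit shift ` {U. U \<in># N \<and> short k U})"

lemma necklace_count_add_rotations:
  assumes "primitive l U" "l \<in> {1..k}" "image_mset shift N = N"
  shows "necklace_count k (N + rotations U) = necklace_count k N + (if U \<in># N then 0 else 1)"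
proof -
  let ?Z = "\<lambda>N. {U. U \<in># N \<and> short k U}"
  have orb: "orbit shift V = orbit shift U" "short k V" if "V \<in> orbit shift U" for V
    using primitive_orbit[OF assms(1) that] assms(2) by (auto simp: short_def)
  have U: "U \<in> orbit shift U" using assms(1) by (simp add: primitive_def)
  have "?Z (N + rotations U) = ?Z N \<union> orbit shift U"
    using orb primitive_finite_orbit[OF assms(1)] by auto
  then have im: "orbit shift ` ?Z (N + rotations U) = insert (orbit shift U) (orbit shift ` ?Z N)"
  proof -
    have "orbit shift ` orbit shift U = {orbit shift U}" using orb(1) U by blast
    then show ?thesis unfolding \<open>?Z (N + rotations U) = _\<close> image_Un by simp
  qed
  have "orbit shift U \<in> orbit shift ` ?Z N \<longleftrightarrow> U \<in># N"
  proof
    assume "orbit shift U \<in> orbit shift ` ?Z N"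
    then obtain V where V: "V \<in># N" "orbit shift U = orbit shift V" by blast
    then have "rotations U \<subseteq># N" using rotations_subset[OF assms(3) V(1)] by simp
    then show "U \<in># N" using primitive_self_in_rotations[OF assms(1)] by (rule mset_subset_eqD)
  next
    assume "U \<in># N"
    then show "orbit shift U \<in> orbit shift ` ?Z N" using orb(2)[OF U] by blast
  qed
  then show ?thesis unfolding necklace_count_def im by (simp add: card_insert_if)
qed

lemma necklace_count_le_size: "necklace_count k N \<le> size N"
proof -
  have "necklace_count k N \<le> card {U. U \<in># N \<and> short k U}"
    unfolding necklace_count_def by (intro card_image_le) simp
  also have "\<dots> \<le> card (set_mset N)" by (intro card_mono) auto
  also have "\<dots> \<le> size N"
    using size_mset_mono[OF mset_set_set_mset_msubset[of N]] by simp
  finally show ?thesis .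
qed

text \<open>A necklace of length l consists of l words, so the weight 1/l counts it once. This is
  the origin of the harmonic sum in all moment bounds.\<close>

lemma sum_card_primitive:
  assumes "image_mset shift N = N"
  shows "(\<Sum>l=1..k. real (card {U. U \<in># N \<and> primitive l U}) / real l) = real (necklace_count k N)"
proof -
  let ?Z = "\<lambda>l. {U. U \<in># N \<and> primitive l U}"
  have Z: "real (card (?Z l)) / real l = real (card (orbit shift ` ?Z l))" if "l \<in> {1..k}" for l
  proof -
    have sub: "orbit shift U \<subseteq> ?Z l" if "U \<in> ?Z l" for U
    proof
      fix V assume "V \<in> orbit shift U"
      then show "V \<in> ?Z l"
        using that primitive_orbit(2)[of l U V] rotations_subset[OF assms, of U] primitive_finite_orbit[of l U]
        by (auto dest: mset_subset_eqD)
    qed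
    moreover have "U \<in> orbit shift U" if "U \<in> ?Z l" for U using that by (simp add: primitive_def)
    ultimately have un: "\<Union> (orbit shift ` ?Z l) = ?Z l" by blast
    have "l * card (orbit shift ` ?Z l) = card (\<Union> (orbit shift ` ?Z l))"
    proof (rule card_partition)
      fix c1 c2 assume c: "c1 \<in> orbit shift ` ?Z l" "c2 \<in> orbit shift ` ?Z l" "c1 \<noteq> c2"
      then obtain U V where UV: "c1 = orbit shift U" "c2 = orbit shift V" "primitive l U" "primitive l V" by blast
      show "c1 \<inter> c2 = {}"
        using c(3) primitive_orbit(1)[OF UV(3)] primitive_orbit(1)[OF UV(4)] unfolding UV(1,2) by blast
    next
      show "finite (\<Union> (orbit shift ` ?Z l))" unfolding un by simp
    qed (auto simp: primitive_def)
    then have "real (card (?Z l)) = real l * real (card (orbit shift ` ?Z l))"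
      by (simp add: un flip: of_nat_mult)
    then show ?thesis using that by simp
  qed
  have "necklace_count k N = card (\<Union>l\<in>{1..k}. orbit shift ` ?Z l)"
    unfolding necklace_count_def short_def by (rule arg_cong[where f=card]) blast
  also have "\<dots> = (\<Sum>l\<in>{1..k}. card (orbit shift ` ?Z l))"
    by (intro card_UN_disjoint) (auto simp: primitive_def)
  finally show ?thesis using Z by simp
qed

definition binomial_moment :: "real pmf \<Rightarrow> nat \<Rightarrow> nat \<Rightarrow> nat \<Rightarrow> real" where
  "binomial_moment p k n r =
    measure_pmf.expectation (cycle_words_pmf p n) (\<lambda>N. real (necklace_count k N choose r))"

lemma binomial_moment_integrable:
  "integrable (cycle_words_pmf p n) (\<lambda>N. real (necklace_count k N choose r))"
proof (rule measure_pmf.integrable_const_bound[where B="real (n choose r)"])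
  show "AE N in cycle_words_pmf p n. norm (real (necklace_count k N choose r)) \<le> real (n choose r)"
    unfolding AE_measure_pmf_iff
  proof
    fix N assume "N \<in> set_pmf (cycle_words_pmf p n)"
    then have "necklace_count k N \<le> n"
      using set_cycle_words_pmf necklace_count_le_size by metis
    then have "necklace_count k N choose r \<le> n choose r"
      by (rule binomial_right_mono)
    then show "norm (real (necklace_count k N choose r)) \<le> real (n choose r)"
      by (simp only: norm_of_nat of_nat_le_iff)
  qed
qed simp

lemma ennreal_binomial_moment:
  "ennreal (binomial_moment p k n r) =
    (\<integral>\<^sup>+N. ennreal (real (necklace_count k N choose r)) \<partial>cycle_words_pmf p n)"
  unfolding binomial_moment_def
  by (rule nn_integral_eq_integral[symmetric]) (simp_all add: binomial_moment_integrable)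

lemma binomial_moment_nonneg: "0 \<le> binomial_moment p k n r"
  by (simp add: binomial_moment_def)

text \<open>The absorption identity turns r times "X choose r" into X times "X - 1 choose r - 1";
  the factor X is expanded by \<open>sum_card_primitive\<close> and the integral formula evaluates
  each summand. The terms with l > n vanish, because a multiset of n words cannot contain all
  rotations of a longer primitive word.\<close>

lemma binomial_moment_size_bias:
  assumes "r > 0"
  shows "ennreal (real r * binomial_moment p k n r) =
    (\<Sum>l=1..k. if l \<le> n then ennreal (1 / real l) * (\<integral>\<^sup>+U. (if primitive l U then
      \<integral>\<^sup>+N. ennreal (real (necklace_count k (N + rotations U) - 1 choose (r - 1)))
        \<partial>cycle_words_pmf p (n - l) else 0) \<partial>periodic_word_pmf p l) else 0)"
proof -
  let ?h = "\<lambda>N. ennreal (real (necklace_count k N - 1 choose (r - 1)))"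
  have "ennreal (real r * binomial_moment p k n r) =
      (\<integral>\<^sup>+N. ennreal (real r) * ennreal (real (necklace_count k N choose r)) \<partial>cycle_words_pmf p n)"
    by (subst nn_integral_cmult) (simp_all add: ennreal_mult binomial_moment_nonneg ennreal_binomial_moment)
  also have "\<dots> = (\<integral>\<^sup>+N. (\<Sum>l=1..k. ennreal (1 / real l) *
      (\<Sum>U | U \<in># N \<and> primitive l U. ?h N)) \<partial>cycle_words_pmf p n)"
  proof (intro nn_integral_cong_AE, unfold AE_measure_pmf_iff, rule ballI)
    fix N assume "N \<in> set_pmf (cycle_words_pmf p n)"
    then have inv: "image_mset shift N = N" by (simp add: set_cycle_words_pmf)
    let ?X = "necklace_count k N"
    have "r * (?X choose r) = ?X * (?X - 1 choose (r - 1))"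
      using assms times_binomial_minus1_eq by blast
    then have "real r * real (?X choose r) = real ?X * real (?X - 1 choose (r - 1))"
      by (metis of_nat_mult)
    also have "\<dots> = (\<Sum>l=1..k. 1 / real l * (real (card {U. U \<in># N \<and> primitive l U}) *
        real (?X - 1 choose (r - 1))))"
      by (subst sum_card_primitive[OF inv, symmetric]) (simp add: sum_distrib_right)
    finally have "ennreal (real r * real (?X choose r)) =
        ennreal (\<Sum>l=1..k. 1 / real l * (real (card {U. U \<in># N \<and> primitive l U}) *
          real (?X - 1 choose (r - 1))))" by simp
    also have "\<dots> = (\<Sum>l=1..k. ennreal (1 / real l) * (\<Sum>U | U \<in># N \<and> primitive l U. ?h N))"
      by (subst sum_ennreal[symmetric])
        (auto simp: ennreal_mult ennreal_of_nat_eq_real_of_nat simp del: times_divide_eq_left intro!: sum.cong)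
    finally show "ennreal (real r) * ennreal (real (?X choose r)) =
      (\<Sum>l=1..k. ennreal (1 / real l) * (\<Sum>U | U \<in># N \<and> primitive l U. ?h N))"
      by (simp add: ennreal_mult)
  qed
  also have "\<dots> = (\<Sum>l=1..k. ennreal (1 / real l) *
      (\<integral>\<^sup>+N. (\<Sum>U | U \<in># N \<and> primitive l U. ?h N) \<partial>cycle_words_pmf p n))"
    by (subst nn_integral_sum) (simp_all add: nn_integral_cmult)
  also have "\<dots> = (\<Sum>l=1..k. if l \<le> n then ennreal (1 / real l) * (\<integral>\<^sup>+U. (if primitive l U then
      \<integral>\<^sup>+N. ?h (N + rotations U) \<partial>cycle_words_pmf p (n - l) else 0) \<partial>periodic_word_pmf p l) else 0)"
  proof (rule sum.cong)
    fix l
    have "(\<integral>\<^sup>+N. (\<Sum>U | U \<in># N \<and> primitive l U. ?h N) \<partial>cycle_words_pmf p n) = 0" if "\<not> l \<le> n"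
    proof -
      have "(\<integral>\<^sup>+N. (\<Sum>U | U \<in># N \<and> primitive l U. ?h N) \<partial>cycle_words_pmf p n) =
          (\<integral>\<^sup>+N. 0 \<partial>cycle_words_pmf p n)"
      proof (intro nn_integral_cong_AE, unfold AE_measure_pmf_iff, rule ballI)
        fix N assume "N \<in> set_pmf (cycle_words_pmf p n)"
        then have "{U. U \<in># N \<and> primitive l U} = {}"
          using primitive_length_le that by blast
        then show "(\<Sum>U | U \<in># N \<and> primitive l U. ?h N) = 0" by (metis sum.empty)
      qed
      then show ?thesis by simp
    qed
    note zero = this
    show "ennreal (1 / real l) * (\<integral>\<^sup>+N. (\<Sum>U | U \<in># N \<and> primitive l U. ?h N) \<partial>cycle_words_pmf p n) =
      (if l \<le> n then ennreal (1 / real l) * (\<integral>\<^sup>+U. (if primitive l U then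
      \<integral>\<^sup>+N. ?h (N + rotations U) \<partial>cycle_words_pmf p (n - l) else 0) \<partial>periodic_word_pmf p l) else 0)"
    proof (cases "l \<le> n")
      case True
      show ?thesis unfolding nn_integral_sum_primitive[OF True] using True by simp
    next
      case False
      show ?thesis unfolding zero[OF False] using False by simp
    qed
  qed simp
  finally show ?thesis .
qed

text \<open>An added orbit creates at most one new necklace, so \<open>necklace_count\<close> of the
  sum minus 1 is at most that of \<open>N\<close>, and size-biasing gives a factor H/(r+1) per step.
  The bound is uniform in \<open>n\<close> and \<open>p\<close>: it is the upper half of a sandwich
  and the majorant for Tannery's theorem.\<close>

lemma binomial_moment_le:
  "binomial_moment p k n r \<le> (\<Sum>l=1..k. 1 / real l) ^ r / fact r"
proof (induction r arbitrary: n)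
  case 0
  then show ?case by (simp add: binomial_moment_def)
next
  case (Suc r)
  let ?H = "\<Sum>l=1..k. 1 / real l"
  have H: "0 \<le> ?H" by (simp add: sum_nonneg)
  have "ennreal (real (Suc r) * binomial_moment p k n (Suc r)) \<le>
      (\<Sum>l=1..k. ennreal (1 / real l * (?H ^ r / fact r)))"
    unfolding binomial_moment_size_bias[OF zero_less_Suc]
  proof (rule sum_mono)
    fix l assume l: "l \<in> {1..k}"
    have "(\<integral>\<^sup>+U. (if primitive l U then \<integral>\<^sup>+N. ennreal (real (necklace_count k (N + rotations U) - 1 choose (Suc r - 1)))
        \<partial>cycle_words_pmf p (n - l) else 0) \<partial>periodic_word_pmf p l) \<le> (\<integral>\<^sup>+U. ennreal (?H ^ r / fact r) \<partial>periodic_word_pmf p l)"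
    proof (rule nn_integral_mono)
      fix U
      have "(\<integral>\<^sup>+N. ennreal (real (necklace_count k (N + rotations U) - 1 choose (Suc r - 1)))
        \<partial>cycle_words_pmf p (n - l)) \<le> ennreal (?H ^ r / fact r)" if "primitive l U"
      proof -
        have "(\<integral>\<^sup>+N. ennreal (real (necklace_count k (N + rotations U) - 1 choose (Suc r - 1)))
          \<partial>cycle_words_pmf p (n - l)) \<le> (\<integral>\<^sup>+N. ennreal (real (necklace_count k N choose r)) \<partial>cycle_words_pmf p (n - l))"
          using necklace_count_add_rotations[OF that l]
          by (intro nn_integral_mono_AE)
            (auto simp: AE_measure_pmf_iff set_cycle_words_pmf intro!: ennreal_leI of_nat_mono binomial_right_mono)
        also have "\<dots> \<le> ennreal (?H ^ r / fact r)"
          unfolding ennreal_binomial_moment[symmetric] by (rule ennreal_leI[OF Suc.IH])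
        finally show ?thesis .
      qed
      then show "(if primitive l U then \<integral>\<^sup>+N. ennreal (real (necklace_count k (N + rotations U) - 1 choose (Suc r - 1)))
        \<partial>cycle_words_pmf p (n - l) else 0) \<le> ennreal (?H ^ r / fact r)" by simp
    qed
    also have "\<dots> = ennreal (?H ^ r / fact r)" by simp
    finally show "(if l \<le> n then ennreal (1 / real l) * (\<integral>\<^sup>+U. (if primitive l U then
      \<integral>\<^sup>+N. ennreal (real (necklace_count k (N + rotations U) - 1 choose (Suc r - 1)))
        \<partial>cycle_words_pmf p (n - l) else 0) \<partial>periodic_word_pmf p l) else 0) \<le> ennreal (1 / real l * (?H ^ r / fact r))"
      using H by (subst ennreal_mult) (auto intro!: mult_left_mono)
  qed
  also have "\<dots> = ennreal (?H * (?H ^ r / fact r))"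
  proof -
    have "(\<Sum>l=1..k. ennreal (1 / real l * (?H ^ r / fact r))) =
        ennreal (\<Sum>l=1..k. 1 / real l * (?H ^ r / fact r))"
      using H by (intro sum_ennreal) simp
    then show ?thesis by (simp only: sum_distrib_right)
  qed
  finally have "real (Suc r) * binomial_moment p k n (Suc r) \<le> ?H * (?H ^ r / fact r)"
    using H by (subst (asm) ennreal_le_iff) auto
  then have "binomial_moment p k n (Suc r) \<le> ?H * (?H ^ r / fact r) / real (Suc r)"
    by (subst pos_le_divide_eq) (simp_all only: mult.commute of_nat_0_less_iff zero_less_Suc)
  also have "\<dots> = ?H ^ Suc r / fact (Suc r)" by (simp add: mult.commute)
  finally show ?case .
qed

text \<open>The converse of the comparison in \<open>binomial_moment_le\<close>. Something is lost
  only if \<open>U\<close> is already present; Pascal's rule measures the loss by a moment of order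
  r - 1, and the presence of \<open>U\<close> contributes its weight, at most
  \<open>\<epsilon>\<close>.\<close>

lemma necklace_moment_step_le:
  assumes "\<And>a. pmf p a \<le> \<epsilon>" "primitive l U" "l \<in> {1..k}"
  shows "ennreal (binomial_moment p k n r) \<le>
    (\<integral>\<^sup>+N. ennreal (real (necklace_count k (N + rotations U) - 1 choose r)) \<partial>cycle_words_pmf p n) +
    ennreal (\<epsilon> * ((\<Sum>l=1..k. 1 / real l) ^ (r - 1) / fact (r - 1)))"
proof -
  let ?H = "\<Sum>l=1..k. 1 / real l"
  have H: "0 \<le> ?H ^ (r - 1) / fact (r - 1)" by (simp add: sum_nonneg)
  let ?X = "necklace_count k"
  let ?err = "\<lambda>N. if U \<in># N then ennreal (real (?X N - 1 choose (r - 1))) else 0"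
  have "ennreal (binomial_moment p k n r) \<le>
    (\<integral>\<^sup>+N. ennreal (real (?X (N + rotations U) - 1 choose r)) + ?err N \<partial>cycle_words_pmf p n)"
    unfolding ennreal_binomial_moment
  proof (intro nn_integral_mono_AE, unfold AE_measure_pmf_iff, rule ballI)
    fix N assume "N \<in> set_pmf (cycle_words_pmf p n)"
    then have inv: "image_mset shift N = N" by (simp add: set_cycle_words_pmf)
    show "ennreal (real (?X N choose r)) \<le> ennreal (real (?X (N + rotations U) - 1 choose r)) + ?err N"
    proof (cases "U \<in># N")
      case True
      \<comment> \<open>Pascal's rule, weakened to an inequality so that it also covers r = 0 and an
        empty count, where the subtractions truncate.\<close>
      have "?X N choose r \<le> (?X N - 1 choose r) + (?X N - 1 choose (r - 1))"
        by (cases "?X N"; cases r) auto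
      then have "ennreal (real (?X N choose r)) \<le>
          ennreal (real (?X N - 1 choose r) + real (?X N - 1 choose (r - 1)))"
        by (intro ennreal_leI) (simp flip: of_nat_add)
      then show ?thesis
        using True necklace_count_add_rotations[OF assms(2,3) inv] by (simp add: ennreal_plus)
    next
      case False
      then show ?thesis using necklace_count_add_rotations[OF assms(2,3) inv] by simp
    qed
  qed
  also have "\<dots> = (\<integral>\<^sup>+N. ennreal (real (?X (N + rotations U) - 1 choose r)) \<partial>cycle_words_pmf p n) +
      (\<integral>\<^sup>+N. ?err N \<partial>cycle_words_pmf p n)"
    by (rule nn_integral_add) simp_all
  also have "(\<integral>\<^sup>+N. ?err N \<partial>cycle_words_pmf p n) \<le> ennreal (\<epsilon> * (?H ^ (r - 1) / fact (r - 1)))"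
  proof (cases "l \<le> n")
    case True
    have "(\<integral>\<^sup>+N. ?err N \<partial>cycle_words_pmf p n) = ennreal (pmf (periodic_word_pmf p l) U) *
        (\<integral>\<^sup>+N. ennreal (real (?X (N + rotations U) - 1 choose (r - 1))) \<partial>cycle_words_pmf p (n - l))"
      by (rule nn_integral_contains_primitive[OF assms(2) True])
    also have "\<dots> \<le> ennreal \<epsilon> * (\<integral>\<^sup>+N. ennreal (real (?X N choose (r - 1))) \<partial>cycle_words_pmf p (n - l))"
      using necklace_count_add_rotations[OF assms(2,3)] pmf_periodic_word_le[OF assms(1,2)]
      by (intro mult_mono nn_integral_mono_AE)
        (auto simp: AE_measure_pmf_iff set_cycle_words_pmf intro!: ennreal_leI of_nat_mono binomial_right_mono)
    also have "\<dots> \<le> ennreal \<epsilon> * ennreal (?H ^ (r - 1) / fact (r - 1))"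
      unfolding ennreal_binomial_moment[symmetric] by (intro mult_left_mono ennreal_leI binomial_moment_le) simp
    also have "\<dots> = ennreal (\<epsilon> * (?H ^ (r - 1) / fact (r - 1)))"
      using pmf_bound_nonneg[OF assms(1)] H by (rule ennreal_mult[symmetric])
    finally show ?thesis .
  next
    case False
    then have "(\<integral>\<^sup>+N. ?err N \<partial>cycle_words_pmf p n) = (\<integral>\<^sup>+N. 0 \<partial>cycle_words_pmf p n)"
      using primitive_length_le[OF _ assms(2)]
      by (intro nn_integral_cong_AE) (auto simp: AE_measure_pmf_iff)
    then show ?thesis by simp
  qed
  finally show ?thesis by (simp add: add_left_mono)
qed

text \<open>The factor \<open>1 - real l ^ 2 * \<epsilon>\<close> is the lower bound for the
  probability that the random word is primitive. The condition \<open>k \<le> n\<close> keeps every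
  length up to k in the size-bias identity.\<close>

lemma binomial_moment_ge:
  assumes "\<And>a. pmf p a \<le> \<epsilon>" "k \<le> n"
  shows "(\<Sum>l=1..k. 1 / real l * ((1 - real l ^ 2 * \<epsilon>) * binomial_moment p k (n - l) r)) \<le>
    real (Suc r) * binomial_moment p k n (Suc r) +
    (\<Sum>l=1..k. 1 / real l) * (\<epsilon> * ((\<Sum>l=1..k. 1 / real l) ^ (r - 1) / fact (r - 1)))"
proof -
  let ?H = "\<Sum>l=1..k. 1 / real l"
  let ?e = "\<epsilon> * (?H ^ (r - 1) / fact (r - 1))"
  let ?w = "\<lambda>l. measure_pmf.prob (periodic_word_pmf p l) {U. primitive l U}"
  let ?I = "\<lambda>l. \<integral>\<^sup>+U. (if primitive l U then
      \<integral>\<^sup>+N. ennreal (real (necklace_count k (N + rotations U) - 1 choose r))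
        \<partial>cycle_words_pmf p (n - l) else 0) \<partial>periodic_word_pmf p l"
  have e: "0 \<le> ?e" using pmf_bound_nonneg[OF assms(1)] by (simp add: sum_nonneg)
  have H: "0 \<le> ?H" by (simp add: sum_nonneg)
  have He: "0 \<le> ?H * ?e" by (rule mult_nonneg_nonneg[OF H e])
  have B: "0 \<le> real (Suc r) * binomial_moment p k n (Suc r)"
    by (intro mult_nonneg_nonneg of_nat_0_le_iff binomial_moment_nonneg)
  have step: "ennreal (?w l * binomial_moment p k (n - l) r) \<le> ?I l + ennreal ?e" if l: "l \<in> {1..k}" for l
  proof -
    have "ennreal (?w l * binomial_moment p k (n - l) r) =
        (\<integral>\<^sup>+U. ennreal (binomial_moment p k (n - l) r) * indicator {U. primitive l U} U \<partial>periodic_word_pmf p l)"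
      by (subst nn_integral_cmult_indicator)
        (simp_all add: measure_pmf.emeasure_eq_measure mult.commute binomial_moment_nonneg flip: ennreal_mult)
    also have "\<dots> \<le> (\<integral>\<^sup>+U. (if primitive l U then
      \<integral>\<^sup>+N. ennreal (real (necklace_count k (N + rotations U) - 1 choose r))
        \<partial>cycle_words_pmf p (n - l) else 0) + ennreal ?e \<partial>periodic_word_pmf p l)"
      using necklace_moment_step_le[where n="n - l" and r=r and p=p, OF assms(1) _ l]
      by (intro nn_integral_mono) auto
    also have "\<dots> = ?I l + ennreal ?e" by (subst nn_integral_add) simp_all
    finally show ?thesis .
  qed
  have "ennreal (\<Sum>l=1..k. 1 / real l * (?w l * binomial_moment p k (n - l) r)) =
      (\<Sum>l=1..k. ennreal (1 / real l) * ennreal (?w l * binomial_moment p k (n - l) r))"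
  proof -
    have "ennreal (\<Sum>l=1..k. 1 / real l * (?w l * binomial_moment p k (n - l) r)) =
        (\<Sum>l=1..k. ennreal (1 / real l * (?w l * binomial_moment p k (n - l) r)))"
      by (rule sum_ennreal[symmetric]) (simp add: binomial_moment_nonneg)
    also have "\<dots> = (\<Sum>l=1..k. ennreal (1 / real l) * ennreal (?w l * binomial_moment p k (n - l) r))"
      by (intro sum.cong refl ennreal_mult) (simp_all add: binomial_moment_nonneg)
    finally show ?thesis .
  qed
  also have "\<dots> \<le> (\<Sum>l=1..k. ennreal (1 / real l) * (?I l + ennreal ?e))"
    by (intro sum_mono mult_left_mono step) auto
  also have "\<dots> = (\<Sum>l=1..k. ennreal (1 / real l) * ?I l) + (\<Sum>l=1..k. ennreal (1 / real l * ?e))"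
  proof -
    have "ennreal (1 / real l) * ennreal ?e = ennreal (1 / real l * ?e)" for l
      using e by (intro ennreal_mult[symmetric]) auto
    then show ?thesis by (simp only: distrib_left sum.distrib)
  qed
  also have "(\<Sum>l=1..k. ennreal (1 / real l) * ?I l) = ennreal (real (Suc r) * binomial_moment p k n (Suc r))"
    unfolding binomial_moment_size_bias[OF zero_less_Suc] diff_Suc_1
    using assms(2) by (intro sum.cong) auto
  also have "(\<Sum>l=1..k. ennreal (1 / real l * ?e)) = ennreal (?H * ?e)"
  proof -
    have "(\<Sum>l=1..k. ennreal (1 / real l * ?e)) = ennreal (\<Sum>l=1..k. 1 / real l * ?e)"
      by (intro sum_ennreal mult_nonneg_nonneg[OF _ e]) auto
    then show ?thesis by (simp only: sum_distrib_right)
  qed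
  also have "ennreal (real (Suc r) * binomial_moment p k n (Suc r)) + ennreal (?H * ?e) =
      ennreal (real (Suc r) * binomial_moment p k n (Suc r) + ?H * ?e)"
    by (rule ennreal_plus[symmetric, OF B He])
  finally have "(\<Sum>l=1..k. 1 / real l * (?w l * binomial_moment p k (n - l) r)) \<le>
      real (Suc r) * binomial_moment p k n (Suc r) + ?H * ?e"
    using add_nonneg_nonneg[OF B He] by (simp only: ennreal_le_iff)
  moreover have "1 - real l ^ 2 * \<epsilon> \<le> ?w l" if "l \<in> {1..k}" for l
    using measure_not_primitive_le[OF assms(1), of l] that
      measure_pmf.prob_compl[of "{U. primitive l U}" "periodic_word_pmf p l"]
    by (simp add: Compl_eq[symmetric] Compl_eq_Diff_UNIV[symmetric] Collect_neg_eq)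
  then have "(\<Sum>l=1..k. 1 / real l * ((1 - real l ^ 2 * \<epsilon>) * binomial_moment p k (n - l) r)) \<le>
      (\<Sum>l=1..k. 1 / real l * (?w l * binomial_moment p k (n - l) r))"
    by (intro sum_mono mult_left_mono mult_right_mono) (auto simp: binomial_moment_nonneg)
  ultimately show ?thesis by linarith
qed

text \<open>The sequence \<open>n\<close> is general because the induction on r applies the claim to
  \<open>n i - l\<close>. Only the lower bound depends on \<open>\<epsilon>\<close>; the upper one
  is the limit itself.\<close>

lemma binomial_moment_tendsto:
  fixes p :: "nat \<Rightarrow> real pmf"
  assumes "\<And>i a. pmf (p i) a \<le> \<epsilon> i" "\<epsilon> \<longlonglongrightarrow> 0"
    and "filterlim n at_top sequentially"
  shows "(\<lambda>i. binomial_moment (p i) k (n i) r) \<longlonglongrightarrow> (\<Sum>l=1..k. 1 / real l) ^ r / fact r"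
  using assms(3)
proof (induction r arbitrary: n)
  case 0
  then show ?case by (simp add: binomial_moment_def)
next
  case (Suc r)
  let ?H = "\<Sum>l=1..k. 1 / real l"
  let ?low = "\<lambda>i. ((\<Sum>l=1..k. 1 / real l * ((1 - real l ^ 2 * \<epsilon> i) * binomial_moment (p i) k (n i - l) r)) -
    ?H * (\<epsilon> i * (?H ^ (r - 1) / fact (r - 1)))) / real (Suc r)"
  have "?low \<longlonglongrightarrow> ((\<Sum>l=1..k. 1 / real l * ((1 - real l ^ 2 * 0) * (?H ^ r / fact r))) -
      ?H * (0 * (?H ^ (r - 1) / fact (r - 1)))) / real (Suc r)"
  proof (intro tendsto_intros assms(2) Suc.IH)
    fix l
    show "filterlim (\<lambda>i. n i - l) at_top sequentially"
      using filterlim_compose[OF filterlim_minus_const_nat_at_top Suc.prems] .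
  qed simp
  also have "((\<Sum>l=1..k. 1 / real l * ((1 - real l ^ 2 * 0) * (?H ^ r / fact r))) -
      ?H * (0 * (?H ^ (r - 1) / fact (r - 1)))) / real (Suc r) = ?H ^ Suc r / fact (Suc r)"
  proof -
    have "(\<Sum>l=1..k. 1 / real l * ((1 - real l ^ 2 * 0) * (?H ^ r / fact r))) = ?H * (?H ^ r / fact r)"
      by (simp only: sum_distrib_right mult_zero_right diff_zero mult_1_left)
    then show ?thesis by simp
  qed
  finally have "?low \<longlonglongrightarrow> ?H ^ Suc r / fact (Suc r)" .
  moreover have "\<forall>\<^sub>F i in sequentially. ?low i \<le> binomial_moment (p i) k (n i) (Suc r)"
  proof -
    have "\<forall>\<^sub>F i in sequentially. k \<le> n i" using Suc.prems by (simp add: filterlim_at_top)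
    then show ?thesis
    proof eventually_elim
      case (elim i)
      have div: "x / real (Suc r) \<le> b" if "x \<le> real (Suc r) * b" for x b
        using that by (subst pos_divide_le_eq) (simp_all only: mult.commute of_nat_0_less_iff zero_less_Suc)
      show ?case using binomial_moment_ge[OF assms(1) elim, of i r] by (intro div) linarith
    qed
  qed
  ultimately show ?case
    using always_eventually[OF allI, OF binomial_moment_le]
    by (rule tendsto_sandwich[rotated 2, OF _ tendsto_const])
qed

lemma alternating_binomial_sum:
  assumes "x \<le> n"
  shows "(\<Sum>r\<le>n. (-1) ^ r * real (x choose r)) = (if x = 0 then 1 else 0)"
proof -
  have "(\<Sum>r\<le>n. (-1) ^ r * real (x choose r)) = (\<Sum>r\<le>x. (-1) ^ r * real (x choose r))"
    using assms by (intro sum.mono_neutral_right) auto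
  also have "\<dots> = (if x = 0 then 1 else 0)"
    using choose_alternating_sum[of x, where 'a=real] by auto
  finally show ?thesis .
qed

text \<open>Inclusion-exclusion. The sum stops at r = n, since at most n necklaces fit; it is
  written as a series to give all n the same form before passing to the limit.\<close>

lemma prob_no_short_necklace:
  "measure_pmf.prob (cycle_words_pmf p n) {N. necklace_count k N = 0} =
    (\<Sum>r. (-1) ^ r * binomial_moment p k n r)"
proof -
  have "measure_pmf.prob (cycle_words_pmf p n) {N. necklace_count k N = 0} =
      measure_pmf.expectation (cycle_words_pmf p n) (indicator {N. necklace_count k N = 0})"
    by simp
  also have "\<dots> = measure_pmf.expectation (cycle_words_pmf p n)
      (\<lambda>N. \<Sum>r\<le>n. (-1) ^ r * real (necklace_count k N choose r))"
  proof (intro integral_cong_AE, simp, simp, unfold AE_measure_pmf_iff, rule ballI)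
    fix N assume "N \<in> set_pmf (cycle_words_pmf p n)"
    then have "necklace_count k N \<le> n"
      using set_cycle_words_pmf necklace_count_le_size by metis
    then show "indicator {N. necklace_count k N = 0} N =
        (\<Sum>r\<le>n. (-1) ^ r * real (necklace_count k N choose r))"
      by (simp add: alternating_binomial_sum)
  qed
  also have "\<dots> = (\<Sum>r\<le>n. (-1) ^ r * binomial_moment p k n r)"
    by (simp add: binomial_moment_def binomial_moment_integrable)
  also have "\<dots> = (\<Sum>r. (-1) ^ r * binomial_moment p k n r)"
  proof (rule suminf_finite[symmetric])
    fix r assume "r \<notin> {..n}"
    then have "binomial_moment p k n r = measure_pmf.expectation (cycle_words_pmf p n) (\<lambda>N. 0)"
      unfolding binomial_moment_def
      by (intro integral_cong_AE)
        (auto simp: AE_measure_pmf_iff dest!: set_cycle_words_pmf intro!: le_less_trans[OF necklace_count_le_size])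
    then show "(-1) ^ r * binomial_moment p k n r = 0" by simp
  qed simp
  finally show ?thesis .
qed

lemma prob_no_short_necklace_tendsto:
  fixes p :: "nat \<Rightarrow> real pmf"
  assumes "\<And>i a. pmf (p i) a \<le> \<epsilon> i" "\<epsilon> \<longlonglongrightarrow> 0"
    and "filterlim n at_top sequentially"
  shows "(\<lambda>i. measure_pmf.prob (cycle_words_pmf (p i) (n i)) {N. necklace_count k N = 0}) \<longlonglongrightarrow>
    exp (- (\<Sum>l=1..k. 1 / real l))"
proof -
  let ?H = "\<Sum>l=1..k. 1 / real l"
  have sums: "(\<lambda>r. x ^ r / fact r) sums exp x" for x :: real
    using exp_converges[of x] by (simp add: field_simps)
  have "(\<lambda>i. \<Sum>r. (-1) ^ r * binomial_moment (p i) k (n i) r) \<longlonglongrightarrow> (\<Sum>r. (-1) ^ r * (?H ^ r / fact r))"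
  proof (rule tannerys_theorem[THEN conjunct2, THEN conjunct2])
    show "(\<lambda>i. (-1) ^ r * binomial_moment (p i) k (n i) r) \<longlonglongrightarrow> (-1) ^ r * (?H ^ r / fact r)" for r
      by (intro tendsto_intros binomial_moment_tendsto[OF assms])
    show "\<forall>\<^sub>F (r, i) in at_top \<times>\<^sub>F sequentially.
        norm ((-1) ^ r * binomial_moment (p i) k (n i) r) \<le> ?H ^ r / fact r"
      by (intro always_eventually)
        (auto simp: abs_mult power_abs binomial_moment_nonneg binomial_moment_le simp del: One_nat_def)
    show "summable (\<lambda>r. ?H ^ r / fact r)" using sums by (rule sums_summable)
  qed simp
  also have "(\<Sum>r. (-1) ^ r * (?H ^ r / fact r)) = exp (- ?H)"
  proof -
    have "(-1) ^ r * (?H ^ r / fact r) = (- ?H) ^ r / fact r" for r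
      by (subst power_minus) simp
    then show ?thesis using sums[of "- ?H"] by (simp only: sums_iff)
  qed
  finally show ?thesis by (simp only: prob_no_short_necklace)
qed

text \<open>The base case of the recursion and the moment computation meet here: counting with or
  without multiplicity gives zero at the same time.\<close>

lemma counts_event_zero: "counts_event k (\<lambda>_. 0) = {N. necklace_count k N = 0}"
  by (auto simp: counts_event_def necklace_count_def size_primitive_def short_def)

lemma counts_event_cong: "(\<And>j. j \<in> {1..k} \<Longrightarrow> m j = m' j) \<Longrightarrow> counts_event k m = counts_event k m'"
  by (simp add: counts_event_def)

text \<open>Induction on the total number of prescribed short cycles; removing one of length l
  lowers that number and shortens the words by l, hence the general sequence
  \<open>n\<close>.\<close>

lemma prob_counts_event_tendsto:
  fixes p :: "nat \<Rightarrow> real pmf"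
  assumes "\<And>i a. pmf (p i) a \<le> \<epsilon> i" "\<epsilon> \<longlonglongrightarrow> 0"
    and "filterlim n at_top sequentially"
  shows "(\<lambda>i. measure_pmf.prob (cycle_words_pmf (p i) (n i)) (counts_event k m)) \<longlonglongrightarrow>
    (\<Prod>l=1..k. pmf (poisson_pmf (1 / real l)) (m l))"
  using assms(3)
proof (induction "\<Sum>l=1..k. m l" arbitrary: m n)
  case 0
  then have m: "m l = 0" if "l \<in> {1..k}" for l using that by simp
  have "(\<Prod>l=1..k. pmf (poisson_pmf (1 / real l)) (m l)) = (\<Prod>l=1..k. exp (- (1 / real l)))"
    using m by (intro prod.cong) auto
  also have "\<dots> = exp (- (\<Sum>l=1..k. 1 / real l))"
    by (simp add: exp_sum flip: sum_negf)
  moreover have "counts_event k m = {N. necklace_count k N = 0}"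
    using m counts_event_cong[of k m "\<lambda>_. 0"] by (simp add: counts_event_zero)
  ultimately show ?case using prob_no_short_necklace_tendsto[OF assms(1,2) "0.prems"] by simp
next
  case (Suc s)
  then obtain l where l: "l \<in> {1..k}" "m l > 0"
    by (metis gr0I sum.neutral nat.distinct(1))
  let ?m = "m(l := m l - 1)" and ?c = "real (l * m l)"
  let ?q = "\<lambda>i. measure_pmf.prob (cycle_words_pmf (p i) (n i)) (counts_event k m)"
  let ?q' = "\<lambda>i. measure_pmf.prob (cycle_words_pmf (p i) (n i - l)) (counts_event k ?m)"
  let ?P = "\<lambda>m. \<Prod>l=1..k. pmf (poisson_pmf (1 / real l)) (m l)"
  have c: "?c > 0" using l by simp
  have split: "(\<Sum>l=1..k. m l) = m l + (\<Sum>j\<in>{1..k} - {l}. m j)"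
    "(\<Sum>l=1..k. ?m l) = m l - 1 + (\<Sum>j\<in>{1..k} - {l}. m j)"
    using l(1) by (simp_all add: sum.remove)
  have "s = (\<Sum>l=1..k. ?m l)" using split Suc.hyps(2) l(2) by linarith
  moreover have lim: "filterlim (\<lambda>i. n i - l) at_top sequentially"
    using filterlim_compose[OF filterlim_minus_const_nat_at_top Suc.prems] .
  ultimately have q': "?q' \<longlonglongrightarrow> ?P ?m" by (rule Suc.hyps(1))
  have "(\<lambda>i. ?c * ?q i - ?q' i) \<longlonglongrightarrow> 0"
  proof (rule Lim_null_comparison)
    have "\<forall>\<^sub>F i in sequentially. l \<le> n i" using Suc.prems by (simp add: filterlim_at_top)
    then show "\<forall>\<^sub>F i in sequentially. norm (?c * ?q i - ?q' i) \<le> ?c * \<epsilon> i + real l ^ 2 * \<epsilon> i"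
      by eventually_elim (simp only: real_norm_def counts_event_recursion[where m=m, OF assms(1) l])
    have "(\<lambda>i. ?c * \<epsilon> i + real l ^ 2 * \<epsilon> i) \<longlonglongrightarrow> ?c * 0 + real l ^ 2 * 0"
      by (intro tendsto_intros assms(2))
    then show "(\<lambda>i. ?c * \<epsilon> i + real l ^ 2 * \<epsilon> i) \<longlonglongrightarrow> 0" by simp
  qed
  from tendsto_add[OF this q'] have "(\<lambda>i. ?c * ?q i) \<longlonglongrightarrow> ?P ?m"
    by (simp only: diff_add_cancel add_0)
  then have "(\<lambda>i. ?c * ?q i / ?c) \<longlonglongrightarrow> ?P ?m / ?c"
    using c by (intro tendsto_divide tendsto_const) linarith+
  moreover have "?P ?m / ?c = ?P m"
  proof -
    have "?P m = pmf (poisson_pmf (1 / real l)) (m l) *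
        (\<Prod>j\<in>{1..k} - {l}. pmf (poisson_pmf (1 / real j)) (m j))"
      using l(1) by (simp add: prod.remove)
    moreover have "?P ?m = pmf (poisson_pmf (1 / real l)) (m l - 1) *
        (\<Prod>j\<in>{1..k} - {l}. pmf (poisson_pmf (1 / real j)) (m j))"
      using l(1) by (simp add: prod.remove)
    \<comment> \<open>The Poisson ratio: with parameter 1/l, passing from m - 1 to m multiplies the
      mass by 1/(l m), which is exactly division by \<open>?c\<close>.\<close>
    moreover obtain t where "m l = Suc t" using l(2) gr0_conv_Suc by blast
    then have "pmf (poisson_pmf (1 / real l)) (m l) = pmf (poisson_pmf (1 / real l)) (m l - 1) / ?c"
      using l(1) by (simp add: field_simps)
    ultimately show ?thesis by simp
  qed
  moreover have "?c * ?q i / ?c = ?q i" for i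
    using c by (intro nonzero_mult_div_cancel_left) linarith
  ultimately show ?case by (simp only:)
qed

section \<open>Cycle counts of random words and weak convergence\<close>

text \<open>Each j-cycle contributes one word of least period j for each of its j positions, so both
  sides count the positions on j-cycles.\<close>

lemma size_primitive_cycle_words:
  "size_primitive j (cycle_words n g) = j * cycle_count n (std n g) j"
proof -
  let ?\<sigma> = "std n g"
  let ?C = "{C \<in> orbit ?\<sigma> ` {1..n}. card C = j}"
  have orb: "orbit ?\<sigma> y = orbit ?\<sigma> x" if "y \<in> orbit ?\<sigma> x" for x y
    using that orbit_swap[OF self_in_orbit_std that] by (auto intro: orbit_trans)
  have sub: "orbit ?\<sigma> x \<subseteq> {1..n}" if "x \<in> {1..n}" for x
    using permutes_orbit_subset[OF std_permutes that] .
  have un: "\<Union> ?C = {x \<in> {1..n}. card (orbit ?\<sigma> x) = j}"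
  proof (rule equalityI; rule subsetI)
    fix y assume "y \<in> \<Union> ?C"
    then obtain x where "x \<in> {1..n}" "card (orbit ?\<sigma> x) = j" "y \<in> orbit ?\<sigma> x" by blast
    then show "y \<in> {x \<in> {1..n}. card (orbit ?\<sigma> x) = j}" using sub[of x] orb[of y x] by auto
  next
    fix y assume "y \<in> {x \<in> {1..n}. card (orbit ?\<sigma> x) = j}"
    then show "y \<in> \<Union> ?C" using self_in_orbit_std[of y n g] by blast
  qed
  have "j * card ?C = card (\<Union> ?C)"
  proof (rule card_partition)
    show "finite (\<Union> ?C)" unfolding un by simp
    fix c1 c2 assume c: "c1 \<in> ?C" "c2 \<in> ?C" "c1 \<noteq> c2"
    then obtain x y where xy: "c1 = orbit ?\<sigma> x" "c2 = orbit ?\<sigma> y" by blast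
    show "c1 \<inter> c2 = {}"
    proof (rule ccontr)
      assume "c1 \<inter> c2 \<noteq> {}"
      then obtain z where "z \<in> orbit ?\<sigma> x" "z \<in> orbit ?\<sigma> y" unfolding xy by blast
      then have "c1 = c2" unfolding xy by (metis orb)
      with c(3) show False by contradiction
    qed
  qed auto
  then have "j * cycle_count n ?\<sigma> j = card {x \<in> {1..n}. card (orbit ?\<sigma> x) = j}"
    unfolding un cycle_count_def .
  also have "{x \<in> {1..n}. card (orbit ?\<sigma> x) = j} = {x \<in> {1..n}. primitive j (cycle_word n g x)}"
    using card_orbit_cycle_word cycle_word_in_orbit by (auto simp: primitive_def)
  also have "card \<dots> = size_primitive j (cycle_words n g)"
    by (simp add: size_primitive_def cycle_words_def filter_mset_image_mset)
  finally show ?thesis ..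
qed

lemma cycle_words_in_counts_event:
  "cycle_words n g \<in> counts_event k m \<longleftrightarrow> (\<forall>j\<in>{1..k}. cycle_count n (std n g) j = m j)"
  by (auto simp: counts_event_def size_primitive_cycle_words)

section \<open>Measurability and law of the random vector\<close>

lemma std_cong:
  assumes "\<And>x y. x \<in> {1..n} \<Longrightarrow> y \<in> {1..n} \<Longrightarrow> g x < g y \<longleftrightarrow> g' x < g' y"
  shows "std n g = std n g'"
proof -
  have "is_std n g' (std n g)"
    using is_std_std[of n g] assms unfolding is_std_def by (metis linorder_neq_iff)
  then show ?thesis using is_std_std[of n g'] ex1_is_std by blast
qed

text \<open>\<open>std\<close> depends only on the finite set of strict comparisons between the
  letters, so the map factors through a finite discrete space.\<close>

lemma measurable_through_comparisons:
  fixes G :: "nat \<Rightarrow> 'a \<Rightarrow> real"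
  assumes "\<And>j. j \<in> {1..n} \<Longrightarrow> G j \<in> borel_measurable M"
    and "\<And>g. f (std n g) \<in> space N"
  shows "(\<lambda>\<omega>. f (std n (\<lambda>j. G j \<omega>))) \<in> measurable M N"
proof -
  define R :: "(nat \<Rightarrow> real) \<Rightarrow> (nat \<times> nat) set"
    where "R g = {(x, y). x \<in> {1..n} \<and> y \<in> {1..n} \<and> g x < g y}" for g
  \<comment> \<open>A representative with the given comparisons is chosen; by
    \<open>std_cong\<close> the choice does not affect \<open>std\<close>.\<close>
  define F where "F r = f (std n (SOME g. R g = r))" for r
  have F: "f (std n g) = F (R g)" for g
  proof -
    have "R (SOME g'. R g' = R g) = R g" by (rule someI[where P="\<lambda>g'. R g' = R g", OF refl])
    then have "std n (SOME g'. R g' = R g) = std n g"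
      by (intro std_cong) (auto simp: R_def set_eq_iff)
    then show ?thesis by (simp add: F_def)
  qed
  let ?A = "Pow ({1..n} \<times> {1..n})"
  have "(\<lambda>\<omega>. R (\<lambda>j. G j \<omega>)) \<in> measurable M (count_space ?A)"
  proof (subst measurable_count_space_eq2, simp, intro conjI ballI)
    show "(\<lambda>\<omega>. R (\<lambda>j. G j \<omega>)) \<in> space M \<rightarrow> ?A" by (auto simp: R_def)
    fix a assume "a \<in> ?A"
    then have "(\<lambda>\<omega>. R (\<lambda>j. G j \<omega>)) -` {a} \<inter> space M =
        {\<omega> \<in> space M. \<forall>x\<in>{1..n}. \<forall>y\<in>{1..n}. G x \<omega> < G y \<omega> \<longleftrightarrow> (x, y) \<in> a}"
      by (fastforce simp: R_def set_eq_iff)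
    also have "\<dots> \<in> sets M"
    proof -
      have "{\<omega> \<in> space M. G x \<omega> < G y \<omega> \<longleftrightarrow> (x, y) \<in> a} \<in> sets M" if "x \<in> {1..n}" "y \<in> {1..n}" for x y
        using assms(1)[OF that(1)] assms(1)[OF that(2)] by measurable
      then show ?thesis by (intro sets.sets_Collect_finite_All) auto
    qed
    finally show "(\<lambda>\<omega>. R (\<lambda>j. G j \<omega>)) -` {a} \<inter> space M \<in> sets M" .
  qed
  moreover have "F \<in> measurable (count_space ?A) N"
    using assms(2) by (simp add: F_def)
  ultimately show ?thesis unfolding F by (rule measurable_compose)
qed

text \<open>The point masses of the \<open>G j\<close> on \<open>I\<close> and independence
  determine the law on the countable support of the product distribution. Setting the vector to 0
  off 1..n matches the default value of \<open>Pi_pmf\<close>. As \<open>A\<close> is arbitrary,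
  measurability of its preimage enters as an assumption.\<close>

lemma measure_iid_vector:
  fixes G :: "nat \<Rightarrow> 'a \<Rightarrow> real" and p :: "real pmf"
  assumes "prob_space M" "n \<ge> 1" "countable I" "set_pmf p \<subseteq> I"
    and indep: "prob_space.indep_vars M (\<lambda>_. borel) G {1..n}"
    and dist: "\<And>j i. j \<in> {1..n} \<Longrightarrow> i \<in> I \<Longrightarrow> measure M {\<omega> \<in> space M. G j \<omega> = i} = pmf p i"
    and sets: "{\<omega> \<in> space M. (\<lambda>j. if j \<in> {1..n} then G j \<omega> else 0) \<in> A} \<in> sets M"
  shows "measure M {\<omega> \<in> space M. (\<lambda>j. if j \<in> {1..n} then G j \<omega> else 0) \<in> A} =
    measure_pmf.prob (Pi_pmf {1..n} 0 (\<lambda>_. p)) A"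
proof -
  interpret prob_space M by fact
  let ?Q = "Pi_pmf {1..n} 0 (\<lambda>_. p)"
  let ?V = "\<lambda>\<omega> j. if j \<in> {1..n} then G j \<omega> else 0"
  let ?S = "\<lambda>w. {\<omega> \<in> space M. ?V \<omega> = w}"
  have [measurable]: "G j \<in> borel_measurable M" if "j \<in> {1..n}" for j
    using indep that by (auto simp: indep_vars_def)
  have S: "?S w = (\<Inter>j\<in>{1..n}. G j -` {w j} \<inter> space M)" if "w \<in> set_pmf ?Q" for w
  proof -
    have "w j = 0" if "j \<notin> {1..n}" for j
      using \<open>w \<in> set_pmf ?Q\<close> that set_Pi_pmf_subset[of "{1..n}" 0 "\<lambda>_. p"] by auto
    then show ?thesis using assms(2) by (auto simp: fun_eq_iff)
  qed
  have S_sets: "?S w \<in> sets M" if "w \<in> set_pmf ?Q" for w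
    unfolding S[OF that] using assms(2) by (intro sets.finite_INT) (auto intro: measurable_sets)
  have S_prob: "emeasure M (?S w) = ennreal (pmf ?Q w)" if w: "w \<in> set_pmf ?Q" for w
  proof -
    have "prob (?S w) = (\<Prod>j\<in>{1..n}. prob (G j -` {w j} \<inter> space M))"
      unfolding S[OF w] using assms(2) by (intro indep_varsD[OF indep]) auto
    also have "\<dots> = (\<Prod>j\<in>{1..n}. pmf p (w j))"
    proof (rule prod.cong)
      fix j assume j: "j \<in> {1..n}"
      have "w j \<in> set_pmf p"
        using w j by (auto simp: set_Pi_pmf PiE_dflt_def)
      then have "w j \<in> I" using assms(4) by blast
      moreover have "G j -` {w j} \<inter> space M = {\<omega> \<in> space M. G j \<omega> = w j}" by auto
      ultimately show "prob (G j -` {w j} \<inter> space M) = pmf p (w j)" using dist[OF j] by simp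
    qed simp
    also have "\<dots> = pmf ?Q w"
      using w set_Pi_pmf_subset[of "{1..n}" 0 "\<lambda>_. p"] by (intro pmf_Pi'[symmetric]) auto
    finally show ?thesis by (simp add: emeasure_eq_measure)
  qed
  have law: "emeasure M {\<omega> \<in> space M. ?V \<omega> \<in> B} = emeasure ?Q B" if B: "B \<subseteq> set_pmf ?Q" for B
  proof -
    have "{\<omega> \<in> space M. ?V \<omega> \<in> B} = (\<Union>w\<in>B. ?S w)" by auto
    also have "emeasure M \<dots> = (\<integral>\<^sup>+w. emeasure M (?S w) \<partial>count_space B)"
      using B S_sets by (intro emeasure_UN_countable)
        (auto simp: disjoint_family_on_def intro: countable_subset[OF B])
    also have "\<dots> = (\<integral>\<^sup>+w. ennreal (pmf ?Q w) \<partial>count_space B)"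
      using B by (intro nn_integral_cong S_prob) auto
    also have "\<dots> = emeasure ?Q B" by (rule nn_integral_pmf)
    finally show ?thesis .
  qed
  have sets': "{\<omega> \<in> space M. ?V \<omega> \<in> B} \<in> sets M" if B: "B \<subseteq> set_pmf ?Q" for B
  proof -
    have "{\<omega> \<in> space M. ?V \<omega> \<in> B} = (\<Union>w\<in>B. ?S w)" by auto
    then show ?thesis using B S_sets
      by (auto intro!: sets.countable_UN' intro: countable_subset[OF B])
  qed
  \<comment> \<open>The support has full mass, so other values of the vector are confined to a null
    set and \<open>A\<close> may be cut down to the support.\<close>
  have "prob {\<omega> \<in> space M. ?V \<omega> \<in> set_pmf ?Q} = 1"
    using law[of "set_pmf ?Q"] by (simp add: emeasure_eq_measure emeasure_pmf)
  then have AE: "AE \<omega> in M. ?V \<omega> \<in> set_pmf ?Q"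
    using sets'[of "set_pmf ?Q"] by (subst (asm) prob_Collect_eq_1) auto
  have "emeasure M {\<omega> \<in> space M. ?V \<omega> \<in> A} = emeasure M {\<omega> \<in> space M. ?V \<omega> \<in> A \<inter> set_pmf ?Q}"
    using AE sets sets'[of "A \<inter> set_pmf ?Q"] by (intro emeasure_eq_AE) auto
  also have "\<dots> = emeasure ?Q (A \<inter> set_pmf ?Q)" by (rule law) simp
  also have "\<dots> = emeasure ?Q A"
    by (intro emeasure_eq_AE) (auto simp: AE_measure_pmf_iff)
  finally show ?thesis by (simp add: emeasure_eq_measure measure_pmf.emeasure_eq_measure)
qed

text \<open>Integral and sum agree on \<open>F\<close>; outside, \<open>f\<close> is bounded by
  \<open>C\<close> and the remaining mass is 1 minus the mass of \<open>F\<close>.\<close>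

lemma integral_finite_support_error:
  fixes f :: "'b \<Rightarrow> real"
  assumes "prob_space N" "f \<in> borel_measurable N" "\<And>v. v \<in> space N \<Longrightarrow> \<bar>f v\<bar> \<le> C"
    and "finite F" "F \<subseteq> space N" "\<And>v. v \<in> F \<Longrightarrow> {v} \<in> sets N"
  shows "\<bar>(\<integral>v. f v \<partial>N) - (\<Sum>v\<in>F. f v * measure N {v})\<bar> \<le> C * (1 - (\<Sum>v\<in>F. measure N {v}))"
proof -
  interpret prob_space N by fact
  have int: "integrable N f"
    using assms(2,3) by (intro integrable_const_bound[where B=C]) auto
  have ind: "integrable N (\<lambda>x. indicator {v} x :: real)" if "v \<in> F" for v
    using assms(6)[OF that] by (intro integrable_real_indicator) (auto simp: emeasure_eq_measure)
  have sum_ind: "(\<Sum>v\<in>F. h v * indicator {v} x) = (if x \<in> F then h x else 0)" for h :: "'b \<Rightarrow> real" and x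
    using assms(4) by (simp add: indicator_def if_distrib sum.delta cong: if_cong)
  have m: "(\<integral>x. (\<Sum>v\<in>F. h v * indicator {v} x) \<partial>N) = (\<Sum>v\<in>F. h v * prob {v})" for h :: "'b \<Rightarrow> real"
    using assms(5,6) ind by (subst Bochner_Integration.integral_sum) auto
  have intF: "integrable N (\<lambda>x. \<Sum>v\<in>F. h v * indicator {v} x)" for h :: "'b \<Rightarrow> real"
    using ind by auto
  have "(\<integral>v. f v \<partial>N) - (\<Sum>v\<in>F. f v * prob {v}) =
      (\<integral>x. f x - (\<Sum>v\<in>F. f v * indicator {v} x) \<partial>N)"
    using int intF by (simp add: m)
  also have "\<bar>\<dots>\<bar> \<le> (\<integral>x. \<bar>f x - (\<Sum>v\<in>F. f v * indicator {v} x)\<bar> \<partial>N)"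
    by (rule integral_abs_bound)
  also have "\<dots> \<le> (\<integral>x. C * (1 - (\<Sum>v\<in>F. 1 * indicator {v} x)) \<partial>N)"
    using int intF[of f] intF[of "\<lambda>_. 1"] assms(3)
    by (intro integral_mono integrable_abs Bochner_Integration.integrable_diff integrable_mult_right integrable_const)
      (simp_all only: sum_ind split: if_splits, auto)
  also have "\<dots> = C * (1 - (\<Sum>v\<in>F. 1 * prob {v}))"
  proof -
    have "(\<integral>x. 1 - (\<Sum>v\<in>F. (1::real) * indicator {v} x) \<partial>N) =
        (\<integral>x. (1::real) \<partial>N) - (\<integral>x. (\<Sum>v\<in>F. (1::real) * indicator {v} x) \<partial>N)"
      by (rule Bochner_Integration.integral_diff[OF integrable_const intF])
    also have "\<dots> = 1 - (\<Sum>v\<in>F. 1 * prob {v})"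
      unfolding m by (simp add: prob_space)
    finally show ?thesis by simp
  qed
  finally show ?thesis by simp
qed

text \<open>Convergence of the point masses to a probability measure prevents mass from escaping: a
  finite set carrying almost all mass of the limit does so for the approximating measures as
  well.\<close>

lemma weak_convergence_countable:
  fixes f :: "'b \<Rightarrow> real"
  assumes A: "\<And>n. prob_space (A n)" "\<And>n. sets (A n) = sets B" and B: "prob_space B"
    and cnt: "countable (space B)" and sng: "\<And>v. v \<in> space B \<Longrightarrow> {v} \<in> sets B"
    and lim: "\<And>v. v \<in> space B \<Longrightarrow> (\<lambda>n. measure (A n) {v}) \<longlonglongrightarrow> measure B {v}"
    and bdd: "\<And>v. v \<in> space B \<Longrightarrow> \<bar>f v\<bar> \<le> C"
  shows "(\<lambda>n. \<integral>v. f v \<partial>A n) \<longlonglongrightarrow> (\<integral>v. f v \<partial>B)"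
proof (rule LIMSEQ_I)
  fix e :: real assume e: "e > 0"
  interpret B: prob_space B by fact
  \<comment> \<open>Every subset of a countable space with measurable singletons is measurable; this
    is used for the limit and for the approximating measures.\<close>
  have meas: "f \<in> borel_measurable N" if "sets N = sets B" for N
  proof (rule measurableI)
    fix S :: "real set"
    have "f -` S \<inter> space B \<in> sets B"
    proof (rule sets.countable)
      show "countable (f -` S \<inter> space B)" by (rule countable_subset[OF _ cnt]) simp
    qed (use sng in auto)
    then show "f -` S \<inter> space N \<in> sets N" using that sets_eq_imp_space_eq[OF that] by simp
  qed simp
  have ne: "space B \<noteq> {}" by (rule B.not_empty)
  have C: "C \<ge> 0" using bdd ne by fastforce
  define F where "F i = from_nat_into (space B) ` {..i}" for i :: nat
  have F: "finite (F i)" "F i \<subseteq> space B" for i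
    using from_nat_into[OF ne] by (auto simp: F_def)
  have Fsum: "measure B (F i) = (\<Sum>v\<in>F i. measure B {v})" for i
    using F sng by (intro B.finite_measure_eq_sum_singleton) auto
  have "F i \<in> sets B" for i
    by (rule sets.countable) (use F sng in \<open>auto intro: countable_finite\<close>)
  moreover have "incseq F" by (force simp: F_def incseq_def)
  ultimately have "(\<lambda>i. measure B (F i)) \<longlonglongrightarrow> measure B (\<Union>i. F i)"
    by (intro B.finite_Lim_measure_incseq) blast
  also have "(\<Union>i. F i) = space B"
  proof
    show "(\<Union>i. F i) \<subseteq> space B" using F by blast
    show "space B \<subseteq> (\<Union>i. F i)"
      using from_nat_into_surj[OF cnt] by (fastforce simp: F_def)
  qed
  \<comment> \<open>The factor 2 provides for two tails: that of \<open>B\<close>, and that of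
    \<open>A n\<close>, whose bound converges to the same value.\<close>
  finally have "(\<lambda>i. 2 * C * (1 - (\<Sum>v\<in>F i. measure B {v}))) \<longlonglongrightarrow> 2 * C * (1 - 1)"
    unfolding B.prob_space Fsum by (intro tendsto_intros)
  then have "\<forall>\<^sub>F i in sequentially. 2 * C * (1 - (\<Sum>v\<in>F i. measure B {v})) < e"
    using e by (intro order_tendstoD(2)) auto
  then obtain i where i: "2 * C * (1 - (\<Sum>v\<in>F i. measure B {v})) < e"
    using eventually_happens by force
  let ?b = "\<lambda>n. \<bar>\<Sum>v\<in>F i. f v * (measure (A n) {v} - measure B {v})\<bar> +
    C * (1 - (\<Sum>v\<in>F i. measure (A n) {v})) + C * (1 - (\<Sum>v\<in>F i. measure B {v}))"
  have "?b \<longlonglongrightarrow> \<bar>\<Sum>v\<in>F i. f v * (measure B {v} - measure B {v})\<bar> +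
    C * (1 - (\<Sum>v\<in>F i. measure B {v})) + C * (1 - (\<Sum>v\<in>F i. measure B {v}))"
    using F(2) by (intro tendsto_intros lim) auto
  then have "\<forall>\<^sub>F n in sequentially. ?b n < e"
    by (rule order_tendstoD(2)) (use i in simp)
  then obtain n0 where n0: "\<And>n. n \<ge> n0 \<Longrightarrow> ?b n < e" by (auto simp: eventually_sequentially)
  have "norm ((\<integral>v. f v \<partial>A n) - (\<integral>v. f v \<partial>B)) < e" if "n \<ge> n0" for n
  proof -
    have sp: "space (A n) = space B" using A(2) by (rule sets_eq_imp_space_eq)
    have "\<bar>(\<integral>v. f v \<partial>A n) - (\<Sum>v\<in>F i. f v * measure (A n) {v})\<bar> \<le> C * (1 - (\<Sum>v\<in>F i. measure (A n) {v}))"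
      using F sng A bdd meas by (intro integral_finite_support_error) (auto simp: sp)
    moreover have "\<bar>(\<integral>v. f v \<partial>B) - (\<Sum>v\<in>F i. f v * measure B {v})\<bar> \<le> C * (1 - (\<Sum>v\<in>F i. measure B {v}))"
      using F sng B bdd meas by (intro integral_finite_support_error) auto
    moreover have "(\<Sum>v\<in>F i. f v * (measure (A n) {v} - measure B {v})) =
        (\<Sum>v\<in>F i. f v * measure (A n) {v}) - (\<Sum>v\<in>F i. f v * measure B {v})"
      by (simp add: right_diff_distrib sum_subtractf)
    ultimately show ?thesis using n0[OF that] unfolding real_norm_def by linarith
  qed
  then show "\<exists>no. \<forall>n\<ge>no. norm ((\<integral>v. f v \<partial>A n) - (\<integral>v. f v \<partial>B)) < e" by blast
qed

text \<open>Passes from the supremum over \<open>I\<close> to a bound on all real letters, the form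
  in which the estimates take \<open>\<epsilon>\<close>.\<close>

lemma sup_pmf_tendsto_zero:
  fixes p :: "nat \<Rightarrow> 'b pmf"
  assumes "\<And>n. n \<ge> 1 \<Longrightarrow> set_pmf (p n) \<subseteq> I" "(\<lambda>n. SUP i\<in>I. pmf (p n) i) \<longlonglongrightarrow> 0"
  shows "(\<lambda>n. SUP a. pmf (p n) a) \<longlonglongrightarrow> 0"
proof (rule tendsto_sandwich[OF _ _ tendsto_const assms(2)])
  have bdd: "bdd_above (pmf (p n) ` A)" for n A
    by (rule bdd_aboveI[where M=1]) (auto simp: pmf_le_1)
  show "\<forall>\<^sub>F n in sequentially. 0 \<le> (SUP a. pmf (p n) a)"
    by (intro always_eventually allI cSUP_upper2[OF bdd, of undefined]) auto
  have "(SUP a. pmf (p n) a) \<le> (SUP i\<in>I. pmf (p n) i)" if n: "n \<ge> 1" for n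
  proof (rule cSUP_least)
    fix a
    show "pmf (p n) a \<le> (SUP i\<in>I. pmf (p n) i)"
    proof (cases "a \<in> set_pmf (p n)")
      case True
      then show ?thesis using assms(1)[OF n] by (intro cSUP_upper bdd) auto
    next
      case False
      \<comment> \<open>A support point lies in \<open>I\<close> and witnesses that the supremum
        over \<open>I\<close> is at least 0, the mass at \<open>a\<close>.\<close>
      obtain b where "b \<in> set_pmf (p n)" using set_pmf_not_empty[of "p n"] by blast
      moreover have "pmf (p n) a = 0" using False by (simp add: set_pmf_iff)
      ultimately show ?thesis using assms(1)[OF n] by (intro cSUP_upper2[OF bdd, of b]) auto
    qed
  qed simp
  then show "\<forall>\<^sub>F n in sequentially. (SUP a. pmf (p n) a) \<le> (SUP i\<in>I. pmf (p n) i)"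
    by (auto simp: eventually_sequentially)
qed

theorem theorem1p4:
  fixes I :: "real set"
    and p :: "nat \<Rightarrow> real pmf"
    and M :: "nat \<Rightarrow> 'a measure"
    and G :: "nat \<Rightarrow> nat \<Rightarrow> 'a \<Rightarrow> real"
    and k :: nat
  assumes "countable I"
    and "\<And>n. n \<ge> 1 \<Longrightarrow> set_pmf (p n) \<subseteq> I"
    and "\<And>n. n \<ge> 1 \<Longrightarrow> prob_space (M n)"
    and "\<And>n. n \<ge> 1 \<Longrightarrow> prob_space.indep_vars (M n) (\<lambda>_. borel) (G n) {1..n}"
    and "\<And>n j i. n \<ge> 1 \<Longrightarrow> j \<in> {1..n} \<Longrightarrow> i \<in> I \<Longrightarrow>
           measure (M n) {\<omega> \<in> space (M n). G n j \<omega> = i} = pmf (p n) i"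
    and "(\<lambda>n. SUP i\<in>I. pmf (p n) i) \<longlonglongrightarrow> 0"
    and "k \<ge> 1"
  shows "weak_conv_on (product_topology (\<lambda>_. euclidean :: nat topology) {1..k})
           (\<lambda>n. distr (M n) (Pi\<^sub>M {1..k} (\<lambda>_. count_space UNIV))
                  (\<lambda>\<omega>. \<lambda>j\<in>{1..k}. cycle_count n (std n (\<lambda>i. G n i \<omega>)) j))
           (Pi\<^sub>M {1..k} (\<lambda>j. measure_pmf (poisson_pmf (1 / real j))))"
proof -
  let ?P = "Pi\<^sub>M {1..k} (\<lambda>_. count_space (UNIV :: nat set))"
  let ?B = "Pi\<^sub>M {1..k} (\<lambda>j. measure_pmf (poisson_pmf (1 / real j)))"
  let ?c = "\<lambda>n \<sigma>. \<lambda>j\<in>{1..k}. cycle_count n \<sigma> j"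
  let ?X = "\<lambda>n \<omega>. ?c n (std n (\<lambda>i. G n i \<omega>))"
  let ?A = "\<lambda>n. distr (M n) ?P (?X n)"
  \<comment> \<open>The largest letter probability is the error parameter of all preceding
    estimates.\<close>
  define \<epsilon> where "\<epsilon> n = (SUP a. pmf (p n) a)" for n
  have \<epsilon>: "pmf (p n) a \<le> \<epsilon> n" for n a
    unfolding \<epsilon>_def by (intro cSUP_upper bdd_aboveI[where M=1]) (auto simp: pmf_le_1)
  have "\<epsilon> \<longlonglongrightarrow> 0"
    unfolding \<epsilon>_def[abs_def] by (rule sup_pmf_tendsto_zero[OF assms(2,6)])
  have setsB: "sets ?B = sets ?P" by (intro sets_PiM_cong) auto
  have spB: "space ?B = (\<Pi>\<^sub>E j\<in>{1..k}. UNIV)" by (simp add: space_PiM)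
  have single: "{v} = (\<Pi>\<^sub>E j\<in>{1..k}. {v j})" if "v \<in> space ?B" for v
    using that unfolding spB by (intro PiE_singleton[symmetric]) (simp add: PiE_def)
  have cnt: "countable (space ?B)"
    unfolding spB by (intro countable_PiE) auto
  have sng: "{v} \<in> sets ?B" if "v \<in> space ?B" for v
    unfolding single[OF that] by (rule sets_PiM_I_finite) auto
  have meas: "?X n \<in> measurable (M n) ?P" if n: "n \<ge> 1" for n
  proof (rule measurable_through_comparisons[where f="?c n"])
    interpret prob_space "M n" by (rule assms(3)[OF n])
    show "G n j \<in> borel_measurable (M n)" if "j \<in> {1..n}" for j
      using assms(4)[OF n] that by (auto simp: indep_vars_def)
  qed (simp add: space_PiM)
  have law: "measure (?A n) {v} = measure_pmf.prob (cycle_words_pmf (p n) n) (counts_event k v)"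
    if n: "n \<ge> 1" and v: "v \<in> space ?B" for n v
  proof -
    let ?V = "\<lambda>\<omega> j. if j \<in> {1..n} then G n j \<omega> else 0"
    let ?E = "cycle_words n -` counts_event k v"
    have "?X n \<omega> = v \<longleftrightarrow> ?V \<omega> \<in> ?E" for \<omega>
    proof -
      \<comment> \<open>Resetting letters outside 1..n leaves all comparisons within 1..n
        unchanged.\<close>
      have std: "std n (?V \<omega>) = std n (\<lambda>i. G n i \<omega>)" by (rule std_cong) simp
      have "v j = undefined" if "j \<notin> {1..k}" for j
        using v that unfolding spB by (auto simp: PiE_def extensional_def)
      then have "?X n \<omega> = v \<longleftrightarrow> (\<forall>j\<in>{1..k}. cycle_count n (std n (\<lambda>i. G n i \<omega>)) j = v j)"
        by (auto simp: fun_eq_iff restrict_def)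
      then show ?thesis by (simp only: vimage_eq cycle_words_in_counts_event std)
    qed
    then have eq: "?X n -` {v} \<inter> space (M n) = {\<omega> \<in> space (M n). ?V \<omega> \<in> ?E}" by blast
    have sets: "?X n -` {v} \<inter> space (M n) \<in> sets (M n)"
      using meas[OF n] sng[OF v] unfolding setsB by (rule measurable_sets)
    have "measure (?A n) {v} = measure (M n) (?X n -` {v} \<inter> space (M n))"
      using meas[OF n] sng[OF v] unfolding setsB by (rule measure_distr)
    also have "\<dots> = measure_pmf.prob (Pi_pmf {1..n} 0 (\<lambda>_. p n)) ?E"
      unfolding eq
      by (rule measure_iid_vector[OF assms(3)[OF n] n assms(1) assms(2)[OF n] assms(4)[OF n] assms(5)[OF n]])
        (use sets in \<open>simp_all only: eq\<close>)
    finally show ?thesis by (simp add: cycle_words_pmf_def)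
  qed
  have probB: "prob_space ?B" by (intro prob_space_PiM measure_pmf.prob_space_axioms)
  have B: "measure ?B {v} = (\<Prod>j=1..k. pmf (poisson_pmf (1 / real j)) (v j))" if v: "v \<in> space ?B" for v
  proof -
    interpret finite_product_prob_space "\<lambda>j. measure_pmf (poisson_pmf (1 / real j))" "{1..k}"
      by unfold_locales simp
    have "measure ?B {v} = (\<Prod>j\<in>{1..k}. measure_pmf.prob (poisson_pmf (1 / real j)) {v j})"
      unfolding single[OF v] by (rule prob_times) simp
    then show ?thesis by (simp add: measure_pmf_single del: One_nat_def)
  qed
  show ?thesis
    unfolding weak_conv_on_def
  proof (intro allI impI)
    fix f :: "(nat \<Rightarrow> nat) \<Rightarrow> real"
    assume f: "continuous_map (product_topology (\<lambda>_. euclidean) {1..k}) euclideanreal f \<and>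
      bounded (f ` topspace (product_topology (\<lambda>_. euclidean) {1..k}))"
    then obtain C where C: "\<And>v. v \<in> space ?B \<Longrightarrow> \<bar>f v\<bar> \<le> C"
      unfolding spB by (auto simp: bounded_iff)
    \<comment> \<open>The index is moved by one because the assumptions on \<open>M n\<close>,
      \<open>G n\<close> and \<open>p n\<close> start at n = 1.\<close>
    have "(\<lambda>n. \<integral>v. f v \<partial>?A (Suc n)) \<longlonglongrightarrow> (\<integral>v. f v \<partial>?B)"
    proof (rule weak_convergence_countable[OF _ _ probB cnt sng _ C])
      show "prob_space (?A (Suc n))" for n
        using assms(3) meas by (intro prob_space.prob_space_distr) auto
      show "sets (?A (Suc n)) = sets ?B" for n by (simp only: sets_distr setsB)
      fix v assume v: "v \<in> space ?B"
      have "(\<lambda>n. measure_pmf.prob (cycle_words_pmf (p (Suc n)) (Suc n)) (counts_event k v)) \<longlonglongrightarrow>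
          (\<Prod>l=1..k. pmf (poisson_pmf (1 / real l)) (v l))"
        using \<epsilon> LIMSEQ_Suc[OF \<open>\<epsilon> \<longlonglongrightarrow> 0\<close>] filterlim_Suc by (rule prob_counts_event_tendsto)
      then show "(\<lambda>n. measure (?A (Suc n)) {v}) \<longlonglongrightarrow> measure ?B {v}"
        by (simp only: B[OF v] law[OF _ v] le_add2 Suc_eq_plus1)
    qed
    then show "(\<lambda>n. \<integral>v. f v \<partial>?A n) \<longlonglongrightarrow> (\<integral>v. f v \<partial>?B)" by (rule LIMSEQ_imp_Suc)
  qed
qed

end
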